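(* Let $1\leq m<n$ be integers. Suppose that $\dim_{\mathrm{qA}}F\leq\max\{m,\overline{\dim}_{\mathrm B}F\}$. If $F\subseteq\mathbb{R}^n$ is bounded then, for almost all $V\in G(n,m)$, $$\overline{\dim}_{\mathrm B}\,\pi_VF=\min\{m,\overline{\dim}_{\mathrm B}F\},$$ and more generally $$\overline{\dim}_{\mathrm B}\,\pi_VF\ \geq\ \overline{\dim}_{\mathrm B}F-\max\{0,\ \dim_{\mathrm{qA}}F-m\}.$$ The same conclusion holds with $\overline{\dim}_{\mathrm B}$ replaced by $\underline{\dim}_{\mathrm B}$. If $F$ is Borel the conclusion holds with $\overline{\dim}_{\mathrm B}$ replaced by $\dim_{\mathrm P}$.
   Context: All sets $F$ are non-empty. $G(n,m)$ is the Grassmannian of $m$-dimensional linear subspaces of $\mathbb{R}^n$, "almost all" refers to its natural invariant measure, and $\pi_V:\mathbb{R}^n\to V$ is orthogonal projection onto $V$. For non-empty bounded $E\subseteq\mathbb{R}^n$ and $r>0$, $N_r(E)$ is the minimum number of sets of diameter $r$ that can cover $E$ (using sets of diameter at most $r$ gives the same dimensions). The lower and upper box dimensions are $\underline{\dim}_{\mathrm B}E=\liminf_{r\to0}\frac{\log N_r(E)}{-\log r}$ and $\overline{\dim}_{\mathrm B}E=\limsup_{r\to0}\frac{\log N_r(E)}{-\log r}$. The packing dimension of a (not necessarily bounded) set $F$ is $\dim_{\mathrm P}F=\inf\{\sup_j\overline{\dim}_{\mathrm B}F_j: F\subseteq\bigcup_{j=1}^\infty F_j \text{ with } F_j\text{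 compact}\}$. For $\theta\in(0,1)$ the upper Assouad spectrum $\overline{\dim}_{\mathrm A}^{\theta}F$ is the infimum of those $\alpha$ for which there is a constant $C>0$ such that $N_r(B(x,R)\cap F)\leq C(R/r)^\alpha$ for all $0<r\leq R^{1/\theta}<R<1$ and all $x\in F$, where $B(x,R)$ is the ball of centre $x$ and radius $R$; it is non-decreasing in $\theta$. The quasi-Assouad dimension is $\dim_{\mathrm{qA}}F=\lim_{\theta\nearrow1}\overline{\dim}_{\mathrm A}^{\theta}F$. *)

theory Defs
  imports "HOL-Probability.Probability"
begin

text \<open>All dimensions take values in \<^typ>\<open>ereal\<close>. The ambient space is
  \<open>real ^ 'n\<close> with \<open>n = CARD('n)\<close>.\<close>


subsection \<open>Orthogonal projections and the Grassmannian\<close>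

definition orth_proj :: "(real ^ 'n) set \<Rightarrow> real ^ 'n \<Rightarrow> real ^ 'n"
  where "orth_proj V x = (THE y. y \<in> V \<and> (\<forall>v\<in>V. orthogonal (x - y) v))"

lemma orth_proj_unique:
  fixes V :: "(real ^ 'n) set"
  assumes "subspace V" "y \<in> V" "\<And>v. v \<in> V \<Longrightarrow> orthogonal (x - y) v"
  shows "orth_proj V x = y"
  unfolding orth_proj_def
proof (rule the_equality)
  show "y \<in> V \<and> (\<forall>v\<in>V. orthogonal (x - y) v)"
    using assms by blast
next
  fix z assume z: "z \<in> V \<and> (\<forall>v\<in>V. orthogonal (x - z) v)"
  have "z - y \<in> V"
    using assms z by (simp add: subspace_diff)
  then have "orthogonal (x - y) (z - y)" "orthogonal (x - z) (z - y)"
    using assms z by blast+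
  then have "(z - y) \<bullet> (z - y) = 0"
    by (simp add: orthogonal_def algebra_simps)
  then show "z = y" by simp
qed

lemma orth_proj_properties:
  fixes V :: "(real ^ 'n) set"
  assumes "subspace V"
  shows "orth_proj V x \<in> V" and "v \<in> V \<Longrightarrow> orthogonal (x - orth_proj V x) v"
proof -
  obtain y z where y: "y \<in> span V" "\<And>w. w \<in> span V \<Longrightarrow> orthogonal z w" "x = y + z"
    by (rule orthogonal_subspace_decomp_exists[of V x]) blast
  then have "y \<in> V" "\<And>w. w \<in> V \<Longrightarrow> orthogonal (x - y) w"
    using assms by (auto simp: span_eq_iff[THEN iffD2])
  moreover from this have "orth_proj V x = y"
    using assms by (intro orth_proj_unique)
  ultimately show "orth_proj V x \<in> V" "v \<in> V \<Longrightarrow> orthogonal (x - orth_proj V x) v"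
    by auto
qed

definition grassmannian :: "nat \<Rightarrow> (real ^ 'n) set set"
  where "grassmannian m = {V. subspace V \<and> dim V = m}"

text \<open>The Grassmannian carries the topology induced by the embedding that sends a subspace to
  the matrix of its orthogonal projection; the preimages of Borel sets of matrices
  under this embedding are exactly the Borel sets of that topology.\<close>

definition borel_grassmannian :: "nat \<Rightarrow> (real ^ 'n) set measure"
  where "borel_grassmannian m =
    vimage_algebra (grassmannian m) (\<lambda>V. matrix (orth_proj V)) borel"

text \<open>The natural measure on the Grassmannian is the unique Borel probability measure
  that is invariant under the action of the orthogonal group.\<close>

definition invariant_grassmannian_measure :: "nat \<Rightarrow> (real ^ 'n) set measure \<Rightarrow> bool"
  where "invariant_grassmannian_measure m \<gamma> \<longleftrightarrow>
    prob_space \<gamma> \<and> sets \<gamma> = sets (borel_grassmannian m) \<and>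
    (\<forall>f. orthogonal_transformation f \<longrightarrow> distr \<gamma> \<gamma> ((`) f) = \<gamma>)"


subsection \<open>Dimensions\<close>

text \<open>The least number of sets of diameter \<open>r\<close> covering \<open>E\<close>. Boundedness is required
  explicitly because \<^const>\<open>diameter\<close> is unspecified for unbounded sets.\<close>

definition covering_number :: "real \<Rightarrow> (real ^ 'n) set \<Rightarrow> nat"
  where "covering_number r E = (LEAST k. \<exists>\<U>. finite \<U> \<and> card \<U> = k \<and>
    (\<forall>U\<in>\<U>. bounded U \<and> diameter U = r) \<and> E \<subseteq> \<Union>\<U>)"

definition lower_box_dim :: "(real ^ 'n) set \<Rightarrow> ereal"
  where "lower_box_dim E =
    Liminf (at_right 0) (\<lambda>r. ereal (ln (real (covering_number r E)) / (- ln r)))"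

definition upper_box_dim :: "(real ^ 'n) set \<Rightarrow> ereal"
  where "upper_box_dim E =
    Limsup (at_right 0) (\<lambda>r. ereal (ln (real (covering_number r E)) / (- ln r)))"

definition packing_dim :: "(real ^ 'n) set \<Rightarrow> ereal"
  where "packing_dim F = Inf {(SUP j. upper_box_dim (K j)) | K :: nat \<Rightarrow> (real ^ 'n) set.
    (\<forall>j. compact (K j) \<and> K j \<noteq> {}) \<and> F \<subseteq> (\<Union>j. K j)}"

definition upper_assouad_spectrum :: "real \<Rightarrow> (real ^ 'n) set \<Rightarrow> ereal"
  where "upper_assouad_spectrum \<theta> F = Inf {ereal \<alpha> | \<alpha>. \<exists>C>0. \<forall>r R. \<forall>x\<in>F.
    0 < r \<and> r \<le> R powr (1 / \<theta>) \<and> R powr (1 / \<theta>) < R \<and> R < 1 \<longrightarrow>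
    real (covering_number r (cball x R \<inter> F)) \<le> C * (R / r) powr \<alpha>}"

definition quasi_assouad_dim :: "(real ^ 'n) set \<Rightarrow> ereal"
  where "quasi_assouad_dim F = Lim (at_left 1) (\<lambda>\<theta>. upper_assouad_spectrum \<theta> F)"

end

theory Submission
  imports Defs
begin

text \<open>For a maximal \<open>\<delta>\<close>-separated subset \<open>E\<close> of a bounded set \<open>F\<close>, count the pairs \<open>(x, y)\<close> in \<open>E \<times> E\<close> with
  \<open>\<bar>\<pi>\<^sub>V (x - y)\<bar> \<le> 4 \<delta>\<close>. By invariance this event has probability at most a constant times \<open>(\<delta> / \<bar>x - y\<bar>)\<^sup>m\<close>, and
  the quasi-Assouad dimension bounds the number of points of \<open>E\<close> in each dyadic annulus around \<open>x\<close>, so the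
  expected number of pairs is at most \<open>card E\<close> times \<open>\<delta>\<close> to a power close to \<open>- max 0 (dim\<^sub>q\<^sub>A F - m)\<close>. Markov's
  inequality and the Borel-Cantelli lemma along \<open>\<delta> = 1 / 2 ^ j\<close> turn this into an almost sure bound, and the
  Cauchy-Schwarz inequality turns few pairs into a large covering number of \<open>\<pi>\<^sub>V F\<close>. This holds at all small
  scales, hence for both box dimensions. Packing dimension is reduced to upper box dimension by
  Baire's theorem on a complete space of which the Borel set \<open>F\<close> is a projection.\<close>

text \<open>The counting exponent \<open>a\<close> must exceed both the quasi-Assouad dimension and
  \<open>m\<close>: for \<open>a > m\<close> the largest annulus dominates a geometric sum and the
  loss is \<delta> to the power \<open>m - a\<close>. Letting \<open>a\<close> decrease to the
  larger of the two numbers produces the term \<open>max 0\<close>. The Assouad spectrum controls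
  only radii with \<open>r \<le> R powr (1 / \<theta>)\<close>; in the missing range of
  \<open>R\<close> the count is at most a small negative power of \<open>r\<close> when \<theta> is
  close to 1, and arbitrarily small losses in the exponent vanish in a box dimension. The factor 4
  comes from rounding a scale \<open>r\<close> to \<open>2 \<delta> \<le> r \<le> 4 \<delta>\<close>
  with dyadic \<delta>: a maximal \<delta>-separated set is at least as large as the covering number
  at scale \<open>2 \<delta>\<close>, while the projection is covered at scale
  \<open>4 \<delta>\<close>. For packing dimension the obstacle is that a cover of the projection is
  chosen after \<open>V\<close>, among uncountably many, whereas only countably many null sets may
  be discarded. A countable basis supplies the test sets, and a closed set above \<open>F\<close>
  makes Baire's theorem applicable although \<open>F\<close> itself need not be complete.\<close>

subsection \<open>Covering numbers\<close>

text \<open>\<open>covering_number\<close> asks for diameter exactly \<open>r\<close>, while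
  estimates produce sets of diameter at most \<open>r\<close>. The union of balls whose radius is
  half the deficit repairs this: two points can be pushed apart along the line through them, so the
  diameter grows by exactly twice the radius.\<close>

lemma bounded_enlarge_diameter:
  fixes U :: "(real ^ 'n) set"
  assumes "0 < r" "bounded U" and le: "\<And>x y. x \<in> U \<Longrightarrow> y \<in> U \<Longrightarrow> dist x y \<le> r"
  obtains W where "U \<subseteq> W" "bounded W" "diameter W = r"
proof (cases "U = {}")
  case True
  with assms show ?thesis
    by (intro that[of "cball 0 (r / 2)"]) auto
next
  case False
  define t where "t = (r - diameter U) / 2"
  have "diameter U \<le> r"
    using le False by (intro diameter_le) (auto simp: dist_norm)
  then have t: "t \<ge> 0" by (simp add: t_def)
  define W where "W = (\<Union>x\<in>U. cball x t)"
  have upper: "dist p q \<le> r" if pq: "p \<in> W" "q \<in> W" for p q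
  proof -
    obtain x y where xy: "x \<in> U" "y \<in> U" "dist x p \<le> t" "dist y q \<le> t"
      using pq unfolding W_def UN_iff mem_cball by blast
    have "dist p q \<le> dist x p + dist x y + dist y q"
      by (metis add_right_mono dist_commute dist_triangle dist_triangle_le)
    also have "\<dots> \<le> t + diameter U + t"
      using xy assms by (intro add_mono diameter_bounded_bound) auto
    finally show ?thesis by (simp add: t_def)
  qed
  have W: "U \<subseteq> W" "W \<noteq> {}" using t False by (auto simp: W_def)
  have bW: "bounded W"
  proof -
    obtain w where "w \<in> W" using W by blast
    then show ?thesis using upper unfolding bounded_def by blast
  qed
  have "diameter W \<le> r"
    using upper W by (intro diameter_le) (auto simp: dist_norm)
  moreover have "r \<le> diameter W"
  proof -
    have "dist x y \<le> diameter W - 2 * t" if "x \<in> U" "y \<in> U" for x y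
    proof -
      obtain u where u: "norm u = 1" "x - y = norm (x - y) *\<^sub>R u"
      proof (cases "x = y")
        case True
        \<comment> \<open>Any unit vector serves for coinciding points; one exists because the index
          type is non-empty.\<close>
        then show ?thesis by (intro that[of "axis undefined 1"]) auto
      next
        case False
        then show ?thesis by (intro that[of "(x - y) /\<^sub>R norm (x - y)"]) auto
      qed
      have "x + t *\<^sub>R u \<in> cball x t" "y - t *\<^sub>R u \<in> cball y t"
        using t u(1) by (auto simp: dist_norm)
      then have "x + t *\<^sub>R u \<in> W" "y - t *\<^sub>R u \<in> W"
        using that unfolding W_def by blast+
      then have "dist (x + t *\<^sub>R u) (y - t *\<^sub>R u) \<le> diameter W"
        using bW by (intro diameter_bounded_bound)
      moreover have "x + t *\<^sub>R u - (y - t *\<^sub>R u) = (norm (x - y) + 2 * t) *\<^sub>R u"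
        using u(2) by (simp add: algebra_simps flip: scaleR_2)
      ultimately show ?thesis
        using u t by (simp add: dist_norm)
    qed
    then have "diameter U \<le> diameter W - 2 * t"
      using False by (intro diameter_le) (auto simp: dist_norm)
    then show ?thesis by (simp add: t_def field_simps)
  qed
  ultimately show ?thesis
    using that[of W] W bW by auto
qed

text \<open>Covers are handled as labellings: the classes of points with a common label form a
  cover. With the converse \<open>covering_number_labelling\<close>, later comparisons of covering
  numbers become compositions of labelling maps.\<close>

lemma covering_number_le_card:
  fixes E :: "(real ^ 'n) set"
  assumes "0 < r" "finite I" "h ` E \<subseteq> I"
    and h: "\<And>x y. x \<in> E \<Longrightarrow> y \<in> E \<Longrightarrow> h x = h y \<Longrightarrow> dist x y \<le> r"
  shows "covering_number r E \<le> card I"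
proof -
  have "\<exists>W. {x\<in>E. h x = i} \<subseteq> W \<and> bounded W \<and> diameter W = r" for i
  proof -
    have "bounded {x\<in>E. h x = i}"
    proof (cases "{x\<in>E. h x = i} = {}")
      case False
      then obtain w where "w \<in> E" "h w = i" by blast
      then have "{x\<in>E. h x = i} \<subseteq> cball w r" using h[of w] by auto
      then show ?thesis by (rule bounded_subset[OF bounded_cball])
    qed (simp only: bounded_empty)
    then obtain W where "{x\<in>E. h x = i} \<subseteq> W" "bounded W" "diameter W = r"
      by (rule bounded_enlarge_diameter[OF \<open>0 < r\<close>]) (use h in auto)
    then show ?thesis by blast
  qed
  then obtain W where W: "\<And>i. {x\<in>E. h x = i} \<subseteq> W i" "\<And>i. bounded (W i)" "\<And>i. diameter (W i) = r"
    by metis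
  have "E \<subseteq> \<Union>(W ` I)" using assms(3) W(1) by fastforce
  then have "covering_number r E \<le> card (W ` I)"
    unfolding covering_number_def using W \<open>finite I\<close> by (intro Least_le exI[of _ "W ` I"]) auto
  then show ?thesis using card_image_le[OF \<open>finite I\<close>, of W] by linarith
qed

text \<open>The \<open>LEAST\<close> is attained only if a finite cover exists; total boundedness
  supplies one.\<close>

lemma covering_number_labelling:
  fixes E :: "(real ^ 'n) set"
  assumes "0 < r" "bounded E"
  obtains h :: "real ^ 'n \<Rightarrow> nat" where "h ` E \<subseteq> {..<covering_number r E}"
    "\<And>x y. x \<in> E \<Longrightarrow> y \<in> E \<Longrightarrow> h x = h y \<Longrightarrow> dist x y \<le> r"
proof -
  obtain K where K: "finite K" "closure E \<subseteq> (\<Union>x\<in>K. ball x (r / 2))"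
    using assms compact_eq_totally_bounded[of "closure E"] compact_closure[of E] by (metis half_gt_zero)
  \<comment> \<open>Balls of radius \<open>r / 2\<close> have diameter exactly \<open>r\<close>
    because the space has positive dimension.\<close>
  define \<U> where "\<U> = (\<lambda>x. cball x (r / 2)) ` K"
  have "finite \<U> \<and> card \<U> = card \<U> \<and> (\<forall>U\<in>\<U>. bounded U \<and> diameter U = r) \<and> E \<subseteq> \<Union>\<U>"
    using K closure_subset[of E] \<open>0 < r\<close> by (force simp: \<U>_def)
  then have "\<exists>\<U>. finite \<U> \<and> card \<U> = covering_number r E \<and> (\<forall>U\<in>\<U>. bounded U \<and> diameter U = r) \<and> E \<subseteq> \<Union>\<U>"
    unfolding covering_number_def
    by (intro LeastI_ex[where P = "\<lambda>k. \<exists>\<U>. finite \<U> \<and> card \<U> = k \<and> (\<forall>U\<in>\<U>. bounded U \<and> diameter U = r) \<and> E \<subseteq> \<Union>\<U>"]) blast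
  then obtain \<U> where U: "finite \<U>" "card \<U> = covering_number r E"
    "\<And>U. U \<in> \<U> \<Longrightarrow> bounded U \<and> diameter U = r" "E \<subseteq> \<Union>\<U>"
    by blast
  obtain \<phi> where \<phi>: "bij_betw \<phi> \<U> {0..<card \<U>}"
    using ex_bij_betw_finite_nat[OF U(1)] by blast
  have "\<forall>x\<in>E. \<exists>U. U \<in> \<U> \<and> x \<in> U" using U(4) by (meson UnionE subsetD)
  then obtain g where g: "\<And>x. x \<in> E \<Longrightarrow> g x \<in> \<U> \<and> x \<in> g x" by metis
  show ?thesis
  proof (rule that[of "\<phi> \<circ> g"])
    show "(\<phi> \<circ> g) ` E \<subseteq> {..<covering_number r E}"
    proof clarify
      fix x assume "x \<in> E"
      then show "(\<phi> \<circ> g) x < covering_number r E"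
        using g[of x] bij_betw_apply[OF \<phi>, of "g x"] U(2) by simp
    qed
    fix x y assume xy: "x \<in> E" "y \<in> E" "(\<phi> \<circ> g) x = (\<phi> \<circ> g) y"
    then have "g x = g y" using g \<phi> by (auto simp: bij_betw_def inj_on_def)
    then show "dist x y \<le> r"
      using g[OF xy(1)] g[OF xy(2)] U(3)[of "g x"] diameter_bounded_bound[of "g x" x y] by auto
  qed
qed

lemma covering_number_mono:
  fixes E :: "(real ^ 'n) set"
  assumes "0 < r" "bounded E'" "E \<subseteq> E'"
  shows "covering_number r E \<le> covering_number r E'"
proof -
  obtain h :: "real ^ 'n \<Rightarrow> nat" where "h ` E' \<subseteq> {..<covering_number r E'}"
    "\<And>x y. x \<in> E' \<Longrightarrow> y \<in> E' \<Longrightarrow> h x = h y \<Longrightarrow> dist x y \<le> r"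
    using covering_number_labelling assms by blast
  then have "covering_number r E \<le> card {..<covering_number r E'}"
    using assms by (intro covering_number_le_card[where h = h]) blast+
  then show ?thesis by simp
qed

lemma covering_number_antimono:
  fixes E :: "(real ^ 'n) set"
  assumes "0 < r" "r \<le> r'" "bounded E"
  shows "covering_number r' E \<le> covering_number r E"
proof -
  obtain h :: "real ^ 'n \<Rightarrow> nat" where h: "h ` E \<subseteq> {..<covering_number r E}"
    "\<And>x y. x \<in> E \<Longrightarrow> y \<in> E \<Longrightarrow> h x = h y \<Longrightarrow> dist x y \<le> r"
    using covering_number_labelling assms by blast
  then have "covering_number r' E \<le> card {..<covering_number r E}"
    using assms by (intro covering_number_le_card[where h = h]) force+
  then show ?thesis by simp
qed

lemma covering_number_image_le:
  fixes E :: "(real ^ 'n) set" and f :: "real ^ 'n \<Rightarrow> real ^ 'n"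
  assumes "0 < r" "bounded E" and f: "\<And>x y. x \<in> E \<Longrightarrow> y \<in> E \<Longrightarrow> dist (f x) (f y) \<le> dist x y"
  shows "covering_number r (f ` E) \<le> covering_number r E"
proof -
  obtain h :: "real ^ 'n \<Rightarrow> nat" where h: "h ` E \<subseteq> {..<covering_number r E}"
    "\<And>x y. x \<in> E \<Longrightarrow> y \<in> E \<Longrightarrow> h x = h y \<Longrightarrow> dist x y \<le> r"
    using covering_number_labelling assms by blast
  have inv: "inv_into E f y \<in> E" "f (inv_into E f y) = y" if "y \<in> f ` E" for y
    using that by (auto simp: inv_into_into f_inv_into_f)
  have "covering_number r (f ` E) \<le> card {..<covering_number r E}"
  proof (rule covering_number_le_card[where h = "h \<circ> inv_into E f"])
    show "(h \<circ> inv_into E f) ` f ` E \<subseteq> {..<covering_number r E}"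
      using h(1) inv by fastforce
    fix x y assume xy: "x \<in> f ` E" "y \<in> f ` E" "(h \<circ> inv_into E f) x = (h \<circ> inv_into E f) y"
    then show "dist x y \<le> r"
      using h(2)[OF inv(1)[OF xy(1)] inv(1)[OF xy(2)]] f[OF inv(1)[OF xy(1)] inv(1)[OF xy(2)]] inv(2) xy
      by simp
  qed (use assms in auto)
  then show ?thesis by simp
qed

lemma covering_number_ge_1:
  fixes E :: "(real ^ 'n) set"
  assumes "0 < r" "bounded E" "E \<noteq> {}"
  shows "1 \<le> covering_number r E"
proof -
  obtain h :: "real ^ 'n \<Rightarrow> nat" where "h ` E \<subseteq> {..<covering_number r E}"
    by (rule covering_number_labelling[OF assms(1,2)])
  then show ?thesis using assms(3) by auto
qed

text \<open>Separated points cannot share a label. A common label only forces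
  \<open>dist x y \<le> r\<close>, hence the strict separation.\<close>

lemma card_separated_le_covering_number:
  fixes E :: "(real ^ 'n) set"
  assumes "0 < r" "bounded E" "D \<subseteq> E" and D: "\<And>x y. x \<in> D \<Longrightarrow> y \<in> D \<Longrightarrow> x \<noteq> y \<Longrightarrow> r < dist x y"
  shows "finite D" "card D \<le> covering_number r E"
proof -
  obtain h :: "real ^ 'n \<Rightarrow> nat" where h: "h ` E \<subseteq> {..<covering_number r E}"
    "\<And>x y. x \<in> E \<Longrightarrow> y \<in> E \<Longrightarrow> h x = h y \<Longrightarrow> dist x y \<le> r"
    using covering_number_labelling assms by blast
  have inj: "inj_on h D"
  proof (rule inj_onI, rule ccontr)
    fix x y assume "x \<in> D" "y \<in> D" "h x = h y" "x \<noteq> y"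
    then show False using h(2)[of x y] D[of x y] \<open>D \<subseteq> E\<close> by auto
  qed
  moreover have sub: "h ` D \<subseteq> {..<covering_number r E}" using h(1) \<open>D \<subseteq> E\<close> by blast
  ultimately show "finite D" by (meson finite_imageD finite_lessThan finite_subset)
  show "card D \<le> covering_number r E"
    using card_inj_on_le[OF inj sub] by simp
qed

text \<open>By maximality of the cardinality every point of \<open>E\<close> is within
  \<open>\<delta>\<close> of \<open>D\<close>. Labelling it by such a point of \<open>D\<close>
  gives classes of diameter at most \<open>2 * \<delta>\<close>.\<close>

lemma exists_maximal_separated:
  fixes E :: "(real ^ 'n) set"
  assumes "0 < \<delta>" "bounded E"
  obtains D where "D \<subseteq> E" "finite D" "\<And>x y. x \<in> D \<Longrightarrow> y \<in> D \<Longrightarrow> x \<noteq> y \<Longrightarrow> \<delta> \<le> dist x y"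
    "covering_number (2 * \<delta>) E \<le> card D"
proof -
  define \<S> where "\<S> = {D. D \<subseteq> E \<and> (\<forall>x\<in>D. \<forall>y\<in>D. x \<noteq> y \<longrightarrow> \<delta> \<le> dist x y)}"
  have \<S>: "finite D \<and> card D < Suc (covering_number (\<delta> / 2) E)" if "D \<in> \<S>" for D
  proof -
    \<comment> \<open>The separation is not strict at \<open>\<delta>\<close>, so cardinalities are
      bounded at half the scale.\<close>
    have "\<delta> / 2 < dist x y" if "x \<in> D" "y \<in> D" "x \<noteq> y" for x y
      using \<open>D \<in> \<S>\<close> that \<open>0 < \<delta>\<close> unfolding \<S>_def by force
    then show ?thesis
      using that card_separated_le_covering_number[of "\<delta> / 2" E D] assms
      by (auto simp: \<S>_def less_Suc_eq_le)
  qed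
  have "{} \<in> \<S>" by (simp add: \<S>_def)
  then obtain D where D: "D \<in> \<S>" "\<And>D'. D' \<in> \<S> \<Longrightarrow> card D' \<le> card D"
    using ex_has_greatest_nat[of "\<lambda>D. D \<in> \<S>" "{}" card "Suc (covering_number (\<delta> / 2) E)"] \<S> by blast
  have near: "\<exists>p\<in>D. dist x p \<le> \<delta>" if "x \<in> E" for x
  proof (rule ccontr)
    assume *: "\<not> ?thesis"
    then have "insert x D \<in> \<S>" "x \<notin> D"
      using D(1) \<open>x \<in> E\<close> \<open>0 < \<delta>\<close> by (auto simp: \<S>_def dist_commute)
    then show False using D \<S>[OF D(1)] D(2)[of "insert x D"] by simp
  qed
  then obtain p where p: "\<And>x. x \<in> E \<Longrightarrow> p x \<in> D \<and> dist x (p x) \<le> \<delta>" by metis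
  have "dist x y \<le> 2 * \<delta>" if "x \<in> E" "y \<in> E" "p x = p y" for x y
    using p[OF that(1)] p[OF that(2)] that dist_triangle2[of x y "p x"] by simp
  then have "covering_number (2 * \<delta>) E \<le> card D"
    using p assms \<S>[OF D(1)] by (intro covering_number_le_card[where h = p]) auto
  with D \<S> show ?thesis by (intro that[of D]) (auto simp: \<S>_def)
qed

lemma covering_number_UN_le:
  fixes E :: "'i \<Rightarrow> (real ^ 'n) set"
  assumes "0 < r" "finite I" "\<And>i. i \<in> I \<Longrightarrow> bounded (E i)"
  shows "covering_number r (\<Union>i\<in>I. E i) \<le> (\<Sum>i\<in>I. covering_number r (E i))"
proof -
  have "\<exists>h :: real ^ 'n \<Rightarrow> nat. h ` E i \<subseteq> {..<covering_number r (E i)} \<and>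
    (\<forall>x\<in>E i. \<forall>y\<in>E i. h x = h y \<longrightarrow> dist x y \<le> r)" if "i \<in> I" for i
    using covering_number_labelling[OF \<open>0 < r\<close> assms(3)[OF that]] by metis
  then obtain h :: "'i \<Rightarrow> real ^ 'n \<Rightarrow> nat" where
    h: "\<And>i. i \<in> I \<Longrightarrow> h i ` E i \<subseteq> {..<covering_number r (E i)}"
      "\<And>i x y. i \<in> I \<Longrightarrow> x \<in> E i \<Longrightarrow> y \<in> E i \<Longrightarrow> h i x = h i y \<Longrightarrow> dist x y \<le> r"
    by metis
  obtain \<iota> where \<iota>: "\<And>x. x \<in> (\<Union>i\<in>I. E i) \<Longrightarrow> \<iota> x \<in> I \<and> x \<in> E (\<iota> x)"
    by (metis UN_E)
  have "covering_number r (\<Union>i\<in>I. E i) \<le> card (SIGMA i:I. {..<covering_number r (E i)})"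
  proof (rule covering_number_le_card[where h = "\<lambda>x. (\<iota> x, h (\<iota> x) x)"])
    show "(\<lambda>x. (\<iota> x, h (\<iota> x) x)) ` (\<Union>i\<in>I. E i) \<subseteq> (SIGMA i:I. {..<covering_number r (E i)})"
      using \<iota> h(1) by blast
    fix x y assume "x \<in> (\<Union>i\<in>I. E i)" "y \<in> (\<Union>i\<in>I. E i)" "(\<iota> x, h (\<iota> x) x) = (\<iota> y, h (\<iota> y) y)"
    then show "dist x y \<le> r" using h(2)[of "\<iota> x" x y] \<iota>[of x] \<iota>[of y] by auto
  qed (use assms in auto)
  then show ?thesis using \<open>finite I\<close> by simp
qed

text \<open>Closing a set does not change its diameter, so the classes of a labelling may be closed.
  This links bounded sets to the compact covers of packing dimension.\<close>

lemma covering_number_closure_le: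
  fixes E :: "(real ^ 'n) set"
  assumes "0 < r" "bounded E"
  shows "covering_number r (closure E) \<le> covering_number r E"
proof -
  obtain h :: "real ^ 'n \<Rightarrow> nat" where h: "h ` E \<subseteq> {..<covering_number r E}"
    "\<And>x y. x \<in> E \<Longrightarrow> y \<in> E \<Longrightarrow> h x = h y \<Longrightarrow> dist x y \<le> r"
    using covering_number_labelling assms by blast
  define A where "A i = {x\<in>E. h x = i}" for i
  have "E = (\<Union>i\<in>{..<covering_number r E}. A i)"
    using h(1) by (auto simp: A_def)
  then have "E \<subseteq> (\<Union>i\<in>{..<covering_number r E}. closure (A i))"
    using closure_subset by blast
  then have "closure E \<subseteq> (\<Union>i\<in>{..<covering_number r E}. closure (A i))"
    by (intro closure_minimal closed_UN) auto
  then have "\<forall>x\<in>closure E. \<exists>i. i \<in> {..<covering_number r E} \<and> x \<in> closure (A i)"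
    by (meson UN_E subsetD)
  then obtain g where g: "\<And>x. x \<in> closure E \<Longrightarrow> g x \<in> {..<covering_number r E} \<and> x \<in> closure (A (g x))"
    by metis
  have cl: "dist x y \<le> r" if "x \<in> closure (A i)" "y \<in> closure (A i)" for x y i
  proof -
    have bdd: "bounded (A i)" using \<open>bounded E\<close> by (rule bounded_subset) (auto simp: A_def)
    have "dist x y \<le> diameter (closure (A i))"
      using that bdd by (intro diameter_bounded_bound) auto
    also have "\<dots> \<le> r"
      using h(2) \<open>0 < r\<close> unfolding diameter_closure[OF bdd]
      by (intro diameter_le) (auto simp: A_def dist_norm)
    finally show ?thesis .
  qed
  have "covering_number r (closure E) \<le> card {..<covering_number r E}"
    using g cl assms by (intro covering_number_le_card[where h = g]) (auto, metis)
  then show ?thesis by simp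
qed

lemma covering_number_subspace_le:
  fixes V :: "(real ^ 'n) set"
  assumes "0 < r" "0 \<le> R" "subspace V"
  shows "real (covering_number r (V \<inter> cball 0 R)) \<le> (2 * R * (real (dim V) + 1) / r + 2) ^ dim V"
proof -
  \<comment> \<open>Mesh of a grid in orthonormal coordinates: \<open>dim V\<close> coordinate
    errors of at most \<open>\<delta>\<close> add up to at most \<open>r\<close>. The
    \<open>+ 1\<close> covers \<open>dim V = 0\<close>.\<close>
  define \<delta> where "\<delta> = r / (real (dim V) + 1)"
  have \<delta>: "0 < \<delta>" "real (dim V) * \<delta> \<le> r"
    using assms by (auto simp: \<delta>_def field_simps)
  obtain B where B: "B \<subseteq> V" "pairwise orthogonal B" "\<And>x. x \<in> B \<Longrightarrow> norm x = 1"
    "independent B" "card B = dim V" "span B = V"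
    using orthonormal_basis_subspace[OF assms(3)] by metis
  have finB: "finite B" using B(4) by (rule independent_imp_finite)
  define h where "h x = restrict (\<lambda>b. \<lfloor>(b \<bullet> x) / \<delta>\<rfloor>) B" for x
  define I where "I = B \<rightarrow>\<^sub>E {\<lfloor>- R / \<delta>\<rfloor>..\<lfloor>R / \<delta>\<rfloor>}"
  have repr: "x = (\<Sum>b\<in>B. (b \<bullet> x) *\<^sub>R b)" if "x \<in> V" for x
  proof -
    have "x \<in> span B" using that B by simp
    then show ?thesis using orthonormal_basis_expand[OF B(2,3) _ finB, of x] by (simp add: inner_commute)
  qed
  have "covering_number r (V \<inter> cball 0 R) \<le> card I"
  proof (rule covering_number_le_card[where h = h])
    show "h ` (V \<inter> cball 0 R) \<subseteq> I"
    proof clarify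
      fix x assume x: "x \<in> V" "x \<in> cball 0 R"
      have "- R / \<delta> \<le> (b \<bullet> x) / \<delta> \<and> (b \<bullet> x) / \<delta> \<le> R / \<delta>" if "b \<in> B" for b
      proof -
        have "\<bar>b \<bullet> x\<bar> \<le> norm b * norm x" by (rule Cauchy_Schwarz_ineq2)
        also have "\<dots> \<le> R" using B(3)[OF that] x by simp
        finally show ?thesis using \<delta>(1) by (auto simp: field_simps abs_le_iff)
      qed
      then show "h x \<in> I" unfolding h_def I_def by (auto intro!: floor_mono)
    qed
    show "finite I" using finB by (auto simp: I_def intro: finite_PiE)
    fix x y assume xy: "x \<in> V \<inter> cball 0 R" "y \<in> V \<inter> cball 0 R" "h x = h y"
    have "x - y \<in> V" using xy assms by (auto intro: subspace_diff)
    then have "dist x y = norm (\<Sum>b\<in>B. (b \<bullet> (x - y)) *\<^sub>R b)"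
      using repr[of "x - y"] by (simp add: dist_norm)
    also have "\<dots> \<le> (\<Sum>b\<in>B. \<delta>)"
    proof (rule sum_norm_le)
      fix b assume b: "b \<in> B"
      then have "\<lfloor>(b \<bullet> x) / \<delta>\<rfloor> = \<lfloor>(b \<bullet> y) / \<delta>\<rfloor>"
        using fun_cong[OF xy(3), of b] by (simp add: h_def)
      then have "\<bar>(b \<bullet> x) / \<delta> - (b \<bullet> y) / \<delta>\<bar> \<le> 1" by linarith
      then have "\<bar>b \<bullet> x - b \<bullet> y\<bar> \<le> \<delta>"
        using \<delta>(1) by (simp add: field_simps abs_le_iff flip: diff_divide_distrib)
      then show "norm ((b \<bullet> (x - y)) *\<^sub>R b) \<le> \<delta>"
        using B(3)[OF b] by (simp add: inner_diff_right)
    qed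
    also have "\<dots> \<le> r" using \<delta> B(5) by simp
    finally show "dist x y \<le> r" .
  qed fact
  then have "real (covering_number r (V \<inter> cball 0 R)) \<le> real (card I)" by simp
  also have "\<dots> = real (card {\<lfloor>- R / \<delta>\<rfloor>..\<lfloor>R / \<delta>\<rfloor>}) ^ dim V"
    using finB B(5) by (simp add: I_def card_PiE)
  also have "\<dots> \<le> (2 * R * (real (dim V) + 1) / r + 2) ^ dim V"
  proof (rule power_mono)
    have "0 \<le> R / \<delta>" using assms \<delta> by simp
    then have "real (card {\<lfloor>- R / \<delta>\<rfloor>..\<lfloor>R / \<delta>\<rfloor>}) \<le> 2 * (R / \<delta>) + 2" by (simp, linarith)
    also have "\<dots> = 2 * R * (real (dim V) + 1) / r + 2" by (simp add: \<delta>_def)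
    finally show "real (card {\<lfloor>- R / \<delta>\<rfloor>..\<lfloor>R / \<delta>\<rfloor>}) \<le> 2 * R * (real (dim V) + 1) / r + 2" .
  qed simp
  finally show ?thesis .
qed

subsection \<open>Orthogonal projections and the invariant measure\<close>

lemma linear_orth_proj:
  fixes V :: "(real ^ 'n) set"
  assumes "subspace V"
  shows "linear (orth_proj V)"
proof (rule linearI)
  note P = orth_proj_properties[OF assms]
  fix x y :: "real ^ 'n" and c :: real
  show "orth_proj V (x + y) = orth_proj V x + orth_proj V y"
  proof (rule orth_proj_unique[OF assms])
    fix v assume "v \<in> V"
    then have "orthogonal (x - orth_proj V x) v" "orthogonal (y - orth_proj V y) v" using P(2) by auto
    then show "orthogonal (x + y - (orth_proj V x + orth_proj V y)) v"
      by (simp add: orthogonal_def inner_diff_left inner_add_left)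
  qed (use P(1) assms in \<open>auto intro: subspace_add\<close>)
  show "orth_proj V (c *\<^sub>R x) = c *\<^sub>R orth_proj V x"
  proof (rule orth_proj_unique[OF assms])
    fix v assume "v \<in> V"
    then have "orthogonal (x - orth_proj V x) v" using P(2) by auto
    then show "orthogonal (c *\<^sub>R x - c *\<^sub>R orth_proj V x) v"
      by (simp add: orthogonal_def flip: scaleR_diff_right)
  qed (use P(1) assms in \<open>auto intro: subspace_scale\<close>)
qed

lemma norm_orth_proj_le:
  fixes V :: "(real ^ 'n) set"
  assumes "subspace V"
  shows "norm (orth_proj V x) \<le> norm x" "norm (x - orth_proj V x) \<le> norm x"
proof -
  have "orthogonal (x - orth_proj V x) (orth_proj V x)"
    using orth_proj_properties[OF assms] by blast
  then have "norm x ^ 2 = norm (x - orth_proj V x) ^ 2 + norm (orth_proj V x) ^ 2"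
    using norm_add_Pythagorean by fastforce
  then have "norm (orth_proj V x) ^ 2 \<le> norm x ^ 2" "norm (x - orth_proj V x) ^ 2 \<le> norm x ^ 2"
    by simp_all
  then show "norm (orth_proj V x) \<le> norm x" "norm (x - orth_proj V x) \<le> norm x"
    by (auto intro: power2_le_imp_le)
qed

lemma dist_orth_proj_le:
  fixes V :: "(real ^ 'n) set"
  assumes "subspace V"
  shows "dist (orth_proj V x) (orth_proj V y) \<le> dist x y"
  using norm_orth_proj_le(1)[OF assms, of "x - y"] linear_diff[OF linear_orth_proj[OF assms]]
  by (simp add: dist_norm)

lemma continuous_on_orth_proj:
  fixes V :: "(real ^ 'n) set"
  assumes "subspace V"
  shows "continuous_on S (orth_proj V)"
  using linear_orth_proj[OF assms] by (simp add: linear_continuous_on linear_conv_bounded_linear)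

lemma bounded_orth_proj_image:
  fixes V :: "(real ^ 'n) set"
  assumes "subspace V" "bounded F"
  shows "bounded (orth_proj V ` F)"
  using assms linear_orth_proj[OF assms(1)] by (simp add: bounded_linear_image linear_conv_bounded_linear)

text \<open>An orthogonal map carries the orthogonal decomposition along \<open>V\<close> to the one
  along the image of \<open>V\<close>.\<close>

lemma orth_proj_orthogonal_image:
  fixes V :: "(real ^ 'n) set"
  assumes "subspace V" "orthogonal_transformation f"
  shows "orth_proj (f ` V) (f x) = f (orth_proj V x)"
proof (rule orth_proj_unique)
  have lin: "linear f" using assms(2) by (simp add: orthogonal_transformation_def)
  show "subspace (f ` V)" using lin assms(1) by (rule linear_subspace_image)
  show "f (orth_proj V x) \<in> f ` V" using orth_proj_properties(1)[OF assms(1)] by blast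
  fix v assume "v \<in> f ` V"
  then obtain w where w: "w \<in> V" "v = f w" by blast
  then show "orthogonal (f x - f (orth_proj V x)) v"
    using assms(2) orth_proj_properties(2)[OF assms(1) w(1), of x]
    by (simp add: orthogonal_def orthogonal_transformation_def flip: linear_diff[OF lin])
qed

section \<open>Volume of tubes around an orthogonal complement\<close>

lemma emeasure_le_covering_number:
  fixes E :: "(real ^ 'n) set"
  assumes "0 < r" "bounded E"
  shows "emeasure lborel E \<le> ennreal (covering_number r E * (unit_ball_vol CARD('n) * r ^ CARD('n)))"
proof -
  obtain h :: "real ^ 'n \<Rightarrow> nat" where h: "h ` E \<subseteq> {..<covering_number r E}"
    "\<And>x y. x \<in> E \<Longrightarrow> y \<in> E \<Longrightarrow> h x = h y \<Longrightarrow> dist x y \<le> r"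
    using covering_number_labelling assms by blast
  \<comment> \<open>A class of diameter at most \<open>r\<close> lies in the ball of radius
    \<open>r\<close> about any of its points.\<close>
  have "\<exists>c. {x\<in>E. h x = i} \<subseteq> cball c r" for i
  proof (cases "{x\<in>E. h x = i} = {}")
    case False
    then obtain w where "w \<in> E" "h w = i" by blast
    then have "{x\<in>E. h x = i} \<subseteq> cball w r" using h(2)[of w] by auto
    then show ?thesis by blast
  qed (simp only: empty_subsetI simp_thms)
  then obtain c where c: "\<And>i. {x\<in>E. h x = i} \<subseteq> cball (c i) r" by metis
  have "E \<subseteq> (\<Union>i\<in>{..<covering_number r E}. cball (c i) r)"
    using h(1) c by fastforce
  then have "emeasure lborel E \<le> emeasure lborel (\<Union>i\<in>{..<covering_number r E}. cball (c i) r)"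
    by (intro emeasure_mono) auto
  also have "\<dots> \<le> (\<Sum>i\<in>{..<covering_number r E}. emeasure lborel (cball (c i) r))"
    by (intro emeasure_subadditive_finite) auto
  also have "\<dots> = ennreal (covering_number r E * (unit_ball_vol CARD('n) * r ^ CARD('n)))"
    using \<open>0 < r\<close> by (simp add: emeasure_cball ennreal_of_nat_eq_real_of_nat ennreal_mult)
  finally show ?thesis .
qed

text \<open>The points lie within \<open>r\<close> of the orthogonal complement \<open>W\<close>. A
  constant times \<open>r\<close> to the power \<open>- dim W\<close> sets of diameter
  \<open>3 * r\<close> cover them, each of volume at most a constant times
  \<open>r ^ CARD('n)\<close>, and \<open>CARD('n) - dim W = dim V\<close>.\<close>

lemma emeasure_tube_le:
  fixes V :: "(real ^ 'n) set"
  assumes "subspace V" "0 < r" "r \<le> 1"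
  shows "emeasure lborel {x \<in> cball 0 1. norm (orth_proj V x) \<le> r}
    \<le> ennreal ((2 * real CARD('n) + 4) ^ CARD('n) * 3 ^ CARD('n) * unit_ball_vol CARD('n) * r ^ dim V)"
proof -
  define W where "W = {y. \<forall>x\<in>V. orthogonal x y}"
  define E where "E = {x \<in> cball 0 1. norm (orth_proj V x) \<le> r}"
  have W: "subspace W" unfolding W_def
    by (auto simp: subspace_def orthogonal_clauses)
  have dimW: "dim W + dim V = CARD('n)"
    using dim_subspace_orthogonal_to_vectors[OF assms(1) subspace_UNIV] by (simp add: W_def)
  have bE: "bounded E" by (rule bounded_subset[OF bounded_cball, of _ 0 1]) (auto simp: E_def)
  let ?N = "covering_number r (W \<inter> cball 0 1)"
  obtain h :: "real ^ 'n \<Rightarrow> nat" where h: "h ` (W \<inter> cball 0 1) \<subseteq> {..<?N}"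
    "\<And>x y. x \<in> W \<inter> cball 0 1 \<Longrightarrow> y \<in> W \<inter> cball 0 1 \<Longrightarrow> h x = h y \<Longrightarrow> dist x y \<le> r"
    using covering_number_labelling[OF \<open>0 < r\<close>, of "W \<inter> cball 0 1"] by (metis bounded_Int bounded_cball)
  have q: "x - orth_proj V x \<in> W \<inter> cball 0 1" if "x \<in> E" for x
    using that orth_proj_properties(2)[OF assms(1)] norm_orth_proj_le(2)[OF assms(1), of x]
    by (auto simp: W_def E_def orthogonal_commute)
  \<comment> \<open>Points with a common label differ by at most \<open>r\<close> along
    \<open>W\<close> and by at most \<open>2 * r\<close> along \<open>V\<close>.\<close>
  have "covering_number (3 * r) E \<le> card {..<?N}"
  proof (rule covering_number_le_card[where h = "\<lambda>x. h (x - orth_proj V x)"])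
    show "(\<lambda>x. h (x - orth_proj V x)) ` E \<subseteq> {..<?N}" using q h(1) by blast
    fix x y assume xy: "x \<in> E" "y \<in> E" "h (x - orth_proj V x) = h (y - orth_proj V y)"
    have "dist x y = norm (((x - orth_proj V x) - (y - orth_proj V y)) + (orth_proj V x - orth_proj V y))"
      by (simp add: dist_norm)
    also have "\<dots> \<le> dist (x - orth_proj V x) (y - orth_proj V y) + (norm (orth_proj V x) + norm (orth_proj V y))"
      unfolding dist_norm by (intro order_trans[OF norm_triangle_ineq] add_left_mono norm_triangle_ineq4)
    also have "\<dots> \<le> r + (r + r)"
      using h(2)[OF q[OF xy(1)] q[OF xy(2)] xy(3)] xy by (intro add_mono) (auto simp: E_def)
    finally show "dist x y \<le> 3 * r" by simp
  qed (use assms in auto)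
  then have "real (covering_number (3 * r) E) \<le> real ?N" by simp
  also have "\<dots> \<le> (2 * 1 * (real (dim W) + 1) / r + 2) ^ dim W"
    by (rule covering_number_subspace_le[OF \<open>0 < r\<close> _ W]) simp
  also have "\<dots> \<le> ((2 * real CARD('n) + 4) / r) ^ dim W"
  proof (rule power_mono)
    have "real (dim W) \<le> real CARD('n)" using dimW by simp
    then have "2 * 1 * (real (dim W) + 1) + 2 * r \<le> 2 * real CARD('n) + 4" using assms by simp
    then have "(2 * 1 * (real (dim W) + 1) + 2 * r) / r \<le> (2 * real CARD('n) + 4) / r"
      using assms by (intro divide_right_mono) auto
    then show "2 * 1 * (real (dim W) + 1) / r + 2 \<le> (2 * real CARD('n) + 4) / r"
      using assms by (simp add: add_divide_distrib)
  qed (use assms in auto)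
  also have "\<dots> \<le> (2 * real CARD('n) + 4) ^ CARD('n) / r ^ dim W"
    using dimW assms by (simp add: power_divide) (intro divide_right_mono power_increasing, auto)
  finally have N: "real (covering_number (3 * r) E) \<le> (2 * real CARD('n) + 4) ^ CARD('n) / r ^ dim W" .
  have "emeasure lborel E \<le> ennreal (covering_number (3 * r) E * (unit_ball_vol CARD('n) * (3 * r) ^ CARD('n)))"
    using assms bE by (intro emeasure_le_covering_number) auto
  also have "\<dots> \<le> ennreal ((2 * real CARD('n) + 4) ^ CARD('n) / r ^ dim W * (unit_ball_vol CARD('n) * (3 * r) ^ CARD('n)))"
    using N assms by (intro ennreal_leI mult_right_mono) auto
  also have "(2 * real CARD('n) + 4) ^ CARD('n) / r ^ dim W * (unit_ball_vol CARD('n) * (3 * r) ^ CARD('n))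
    = (2 * real CARD('n) + 4) ^ CARD('n) * 3 ^ CARD('n) * unit_ball_vol CARD('n) * (r ^ CARD('n) / r ^ dim W)"
    by (simp add: power_mult_distrib)
  also have "r ^ CARD('n) / r ^ dim W = r ^ dim V"
    using assms dimW by (metis add_diff_cancel_left' le_add1 less_numeral_extra(3) power_diff)
  finally show ?thesis unfolding E_def .
qed

section \<open>Probability of a small projection\<close>

context
  fixes m :: nat and \<gamma> :: "(real ^ 'n) set measure"
  assumes inv: "invariant_grassmannian_measure m \<gamma>"
begin

lemma space_invariant_measure: "space \<gamma> = grassmannian m"
  using inv sets_eq_imp_space_eq[of \<gamma> "borel_grassmannian m"]
  by (simp add: invariant_grassmannian_measure_def borel_grassmannian_def)

lemma in_space_invariant_measure: "V \<in> space \<gamma> \<longleftrightarrow> subspace V \<and> dim V = m"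
  by (simp add: space_invariant_measure grassmannian_def)

lemma measurable_matrix_orth_proj: "(\<lambda>V. matrix (orth_proj V)) \<in> borel_measurable \<gamma>"
proof -
  have "(\<lambda>V. matrix (orth_proj V)) \<in> borel_measurable (borel_grassmannian m)"
    unfolding borel_grassmannian_def by (rule measurable_vimage_algebra1) simp
  then show ?thesis
    using inv by (simp add: invariant_grassmannian_measure_def cong: measurable_cong_sets)
qed

lemma matrix_orth_proj_mult: "V \<in> space \<gamma> \<Longrightarrow> matrix (orth_proj V) *v x = orth_proj V x"
  using linear_orth_proj[of V] by (simp add: in_space_invariant_measure matrix_works linear_def scalar_mult_eq_scaleR)

lemma measurable_orth_proj: "(\<lambda>V. orth_proj V x) \<in> borel_measurable \<gamma>"
proof -
  have "continuous_on UNIV (\<lambda>A :: real ^ 'n ^ 'n. A *v x)"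
    unfolding matrix_vector_mult_def by (intro continuous_intros)
  then have "(\<lambda>V. matrix (orth_proj V) *v x) \<in> borel_measurable \<gamma>"
    by (intro measurable_compose[OF measurable_matrix_orth_proj] borel_measurable_continuous_onI)
  then show ?thesis
    by (simp add: matrix_orth_proj_mult cong: measurable_cong)
qed

text \<open>Joint measurability is what Fubini requires; it holds because matrix-vector
  multiplication is continuous in both arguments together.\<close>

lemma measurable_orth_proj_pair:
  "(\<lambda>p. orth_proj (fst p) (snd p)) \<in> borel_measurable (\<gamma> \<Otimes>\<^sub>M lborel)"
proof -
  have "continuous_on UNIV (\<lambda>p :: (real ^ 'n ^ 'n) \<times> (real ^ 'n). fst p *v snd p)"
    unfolding matrix_vector_mult_def by (intro continuous_intros)
  then have *: "(\<lambda>p :: (real ^ 'n ^ 'n) \<times> (real ^ 'n). fst p *v snd p) \<in> borel_measurable (borel \<Otimes>\<^sub>M borel)"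
    unfolding borel_prod by (rule borel_measurable_continuous_onI)
  have "(\<lambda>p. (matrix (orth_proj (fst p)), snd p)) \<in> (\<gamma> \<Otimes>\<^sub>M lborel) \<rightarrow>\<^sub>M (borel \<Otimes>\<^sub>M borel)"
    by (intro measurable_Pair measurable_compose[OF measurable_fst measurable_matrix_orth_proj]) simp
  from measurable_compose[OF this *]
  have "(\<lambda>p. matrix (orth_proj (fst p)) *v snd p) \<in> borel_measurable (\<gamma> \<Otimes>\<^sub>M lborel)"
    by simp
  moreover have "(\<lambda>p. matrix (orth_proj (fst p)) *v snd p) \<in> borel_measurable (\<gamma> \<Otimes>\<^sub>M lborel) \<longleftrightarrow> ?thesis"
    by (rule measurable_cong) (auto simp: matrix_orth_proj_mult space_pair_measure)
  ultimately show ?thesis by simp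
qed

text \<open>On projection matrices the action of \<open>f\<close> is conjugation, which is
  continuous, and the measurable sets of subspaces are pulled back from these matrices.\<close>

lemma measurable_image_orthogonal:
  assumes f: "orthogonal_transformation f"
  shows "(`) f \<in> \<gamma> \<rightarrow>\<^sub>M \<gamma>"
proof -
  have lin: "linear f" using f by (simp add: orthogonal_transformation_def)
  have finv: "linear (Hilbert_Choice.inv f)" "\<And>y. f (Hilbert_Choice.inv f y) = y"
    using orthogonal_transformation_inv[OF f] orthogonal_transformation_surj[OF f]
    by (auto simp: orthogonal_transformation_def surj_f_inv_f)
  have sp: "f ` V \<in> space \<gamma>" if "V \<in> space \<gamma>" for V
    using that lin f unfolding in_space_invariant_measure
    using dim_image_eq[OF lin inj_on_subset[OF orthogonal_transformation_inj[OF f] subset_UNIV], of V]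
    by (simp add: linear_subspace_image)
  have *: "matrix (orth_proj (f ` V)) = matrix f ** matrix (orth_proj V) ** matrix (Hilbert_Choice.inv f)"
    if "V \<in> space \<gamma>" for V
  proof -
    have V: "subspace V" using that by (simp add: in_space_invariant_measure)
    have "orth_proj (f ` V) = f \<circ> orth_proj V \<circ> Hilbert_Choice.inv f"
    proof
      fix y show "orth_proj (f ` V) y = (f \<circ> orth_proj V \<circ> Hilbert_Choice.inv f) y"
        using orth_proj_orthogonal_image[OF V f, of "Hilbert_Choice.inv f y"] finv(2) by simp
    qed
    then show ?thesis
      using lin finv linear_orth_proj[OF V] by (simp add: matrix_compose linear_compose)
  qed
  have "continuous_on UNIV (\<lambda>A :: real ^ 'n ^ 'n. matrix f ** A ** matrix (Hilbert_Choice.inv f))"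
    unfolding matrix_matrix_mult_def by (intro continuous_intros)
  then have "(\<lambda>V. matrix f ** matrix (orth_proj V) ** matrix (Hilbert_Choice.inv f)) \<in> borel_measurable \<gamma>"
    by (intro measurable_compose[OF measurable_matrix_orth_proj] borel_measurable_continuous_onI)
  then have "(\<lambda>V. matrix (orth_proj (f ` V))) \<in> borel_measurable \<gamma>"
    by (simp add: * cong: measurable_cong)
  then have "(`) f \<in> \<gamma> \<rightarrow>\<^sub>M borel_grassmannian m"
    unfolding borel_grassmannian_def using sp
    by (intro measurable_vimage_algebra2) (auto simp: space_invariant_measure)
  then show ?thesis
    using inv by (simp add: invariant_grassmannian_measure_def cong: measurable_cong_sets)
qed

lemma sets_small_proj: "{V\<in>space \<gamma>. norm (orth_proj V x) \<le> r} \<in> sets \<gamma>"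
  using measurable_orth_proj[of x] by measurable

lemma emeasure_small_proj_rotate:
  assumes f: "orthogonal_transformation f"
  shows "emeasure \<gamma> {V\<in>space \<gamma>. norm (orth_proj V (f x)) \<le> r} =
    emeasure \<gamma> {V\<in>space \<gamma>. norm (orth_proj V x) \<le> r}"
proof -
  let ?A = "{V\<in>space \<gamma>. norm (orth_proj V (f x)) \<le> r}"
  have "emeasure \<gamma> ?A = emeasure (distr \<gamma> \<gamma> ((`) f)) ?A"
    using inv f by (simp add: invariant_grassmannian_measure_def)
  also have "\<dots> = emeasure \<gamma> ((`) f -` ?A \<inter> space \<gamma>)"
    using measurable_image_orthogonal[OF f] sets_small_proj by (rule emeasure_distr)
  also have "(`) f -` ?A \<inter> space \<gamma> = {V\<in>space \<gamma>. norm (orth_proj V x) \<le> r}"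
  proof -
    have "norm (orth_proj (f ` V) (f x)) = norm (orth_proj V x)" "f ` V \<in> space \<gamma>" if "V \<in> space \<gamma>" for V
      using that orth_proj_orthogonal_image[OF _ f, of V x] orthogonal_transformation_norm[OF f]
        measurable_space[OF measurable_image_orthogonal[OF f] that]
      by (simp_all add: in_space_invariant_measure)
    then show ?thesis by auto
  qed
  finally show ?thesis .
qed

text \<open>A rotation takes the direction of \<open>e\<close> to that of \<open>x\<close>, and
  scaling a unit vector down to \<open>norm x\<close> only enlarges the event.\<close>

lemma emeasure_small_proj_mono:
  assumes "norm e = 1" "norm x \<le> 1"
  shows "emeasure \<gamma> {V\<in>space \<gamma>. norm (orth_proj V e) \<le> r} \<le> emeasure \<gamma> {V\<in>space \<gamma>. norm (orth_proj V x) \<le> r}"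
proof -
  obtain f where f: "orthogonal_transformation f" "f (norm x *\<^sub>R e) = x"
    using orthogonal_transformation_exists[of "norm x *\<^sub>R e" x] assms by auto
  have "norm (orth_proj V (norm x *\<^sub>R e)) \<le> r" if "V \<in> space \<gamma>" "norm (orth_proj V e) \<le> r" for V
  proof -
    have "norm (orth_proj V (norm x *\<^sub>R e)) = norm x * norm (orth_proj V e)"
      using that by (simp add: in_space_invariant_measure linear_scale[OF linear_orth_proj])
    also have "\<dots> \<le> 1 * norm (orth_proj V e)" using assms by (intro mult_right_mono) auto
    finally show ?thesis using that by simp
  qed
  then have "emeasure \<gamma> {V\<in>space \<gamma>. norm (orth_proj V e) \<le> r} \<le>
      emeasure \<gamma> {V\<in>space \<gamma>. norm (orth_proj V (norm x *\<^sub>R e)) \<le> r}"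
    by (intro emeasure_mono sets_small_proj) auto
  then show ?thesis
    using emeasure_small_proj_rotate[OF f(1), of "norm x *\<^sub>R e" r] f(2) by simp
qed

text \<open>By invariance the measure in question does not depend on the direction of \<open>x\<close>, so it is at most its
  average over all \<open>x\<close> in the unit ball, and by Fubini this average is the mean volume of a tube.\<close>

lemma measure_small_proj_le:
  obtains c where "0 < c" "\<And>x \<rho>. x \<noteq> 0 \<Longrightarrow> 0 < \<rho> \<Longrightarrow>
    measure \<gamma> {V\<in>space \<gamma>. norm (orth_proj V x) \<le> \<rho>} \<le> c * (\<rho> / norm x) ^ m"
proof -
  interpret prob_space \<gamma> using inv by (simp add: invariant_grassmannian_measure_def)
  interpret pair_sigma_finite \<gamma> "lborel :: (real ^ 'n) measure" ..
  define v where "v = unit_ball_vol (real CARD('n))"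
  define C where "C = (2 * real CARD('n) + 4) ^ CARD('n) * 3 ^ CARD('n)"
  have v: "0 < v" by (simp add: v_def)
  have C: "1 \<le> C" unfolding C_def
    by (rule order_trans[OF _ mult_mono[of 1 _ 1]]) (auto intro!: one_le_power)
  have unit_small: "measure \<gamma> {V\<in>space \<gamma>. norm (orth_proj V e) \<le> r} \<le> C * r ^ m"
    if e: "norm e = 1" and r: "0 < r" "r \<le> 1" for e r
  proof -
    let ?g = "measure \<gamma> {V\<in>space \<gamma>. norm (orth_proj V e) \<le> r}"
    \<comment> \<open>Incidence of subspaces and points of the unit ball; its two iterated integrals
      are compared.\<close>
    define T where "T = (\<lambda>p. indicator {p. norm (snd p) \<le> 1 \<and> norm (orth_proj (fst p) (snd p)) \<le> r} (p :: (real ^ 'n) set \<times> (real ^ 'n)) :: ennreal)"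
    have T: "T \<in> borel_measurable (\<gamma> \<Otimes>\<^sub>M lborel)"
      unfolding T_def using measurable_orth_proj_pair by measurable
    have "ennreal ?g * ennreal v = (\<integral>\<^sup>+ x. ennreal ?g * indicator (cball 0 1) x \<partial>(lborel :: (real ^ 'n) measure))"
      by (simp add: nn_integral_cmult_indicator emeasure_cball v_def)
    also have "\<dots> \<le> (\<integral>\<^sup>+ x. (\<integral>\<^sup>+ V. T (V, x) \<partial>\<gamma>) \<partial>lborel)"
    proof (rule nn_integral_mono)
      fix x :: "real ^ 'n"
      show "ennreal ?g * indicator (cball 0 1) x \<le> (\<integral>\<^sup>+ V. T (V, x) \<partial>\<gamma>)"
      proof (cases "norm x \<le> 1")
        case True
        have "(\<integral>\<^sup>+ V. T (V, x) \<partial>\<gamma>) = (\<integral>\<^sup>+ V. indicator {V\<in>space \<gamma>. norm (orth_proj V x) \<le> r} V \<partial>\<gamma>)"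
          using True by (intro nn_integral_cong) (auto simp: T_def indicator_def)
        also have "\<dots> = emeasure \<gamma> {V\<in>space \<gamma>. norm (orth_proj V x) \<le> r}"
          using sets_small_proj by simp
        finally show ?thesis
          using emeasure_small_proj_mono[OF e True, of r] True by (simp add: emeasure_eq_measure)
      qed auto
    qed
    also have "\<dots> = (\<integral>\<^sup>+ V. (\<integral>\<^sup>+ x. T (V, x) \<partial>lborel) \<partial>\<gamma>)"
      using T by (intro Fubini'[of "\<lambda>V x. T (V, x)"]) simp
    also have "\<dots> \<le> (\<integral>\<^sup>+ V. ennreal (C * v * r ^ m) \<partial>\<gamma>)"
    proof (rule nn_integral_mono)
      fix V assume V: "V \<in> space \<gamma>"
      then have sub: "subspace V" "dim V = m" by (auto simp: in_space_invariant_measure)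
      have "(\<integral>\<^sup>+ x. T (V, x) \<partial>lborel) = (\<integral>\<^sup>+ x. indicator {x \<in> cball 0 1. norm (orth_proj V x) \<le> r} x \<partial>lborel)"
        by (intro nn_integral_cong) (auto simp: T_def indicator_def)
      also have "\<dots> = emeasure lborel {x \<in> cball 0 1. norm (orth_proj V x) \<le> r}"
      proof (rule nn_integral_indicator)
        have "closed {x \<in> cball 0 1. norm (orth_proj V x) \<le> r}"
          by (simp only: mem_cball Collect_conj_eq) (intro closed_Int closed_Collect_le continuous_intros continuous_on_orth_proj sub)
        then show "{x \<in> cball 0 1. norm (orth_proj V x) \<le> r} \<in> sets lborel" by simp
      qed
      also have "\<dots> \<le> ennreal (C * v * r ^ m)"
        using emeasure_tube_le[OF sub(1) r] sub(2) by (simp add: C_def v_def)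
      finally show "(\<integral>\<^sup>+ x. T (V, x) \<partial>lborel) \<le> ennreal (C * v * r ^ m)" .
    qed
    also have "\<dots> = ennreal (C * v * r ^ m)" by (simp add: emeasure_space_1)
    finally have "?g * v \<le> C * v * r ^ m"
      using v C r by (simp flip: ennreal_mult)
    then show ?thesis using v by (simp add: field_simps)
  qed
  \<comment> \<open>For \<open>r > 1\<close> the bound is trivial because
    \<open>C \<ge> 1\<close>.\<close>
  have unit: "measure \<gamma> {V\<in>space \<gamma>. norm (orth_proj V e) \<le> r} \<le> C * r ^ m"
    if "norm e = 1" "0 < r" for e r
  proof (cases "r \<le> 1")
    case False
    then have "1 * 1 \<le> C * r ^ m" using C by (intro mult_mono one_le_power) auto
    then show ?thesis using order_trans[OF prob_le_1] by simp
  qed (use unit_small that in auto)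
  show ?thesis
  proof (rule that[of C])
    show "0 < C" using C by simp
    fix x :: "real ^ 'n" and \<rho> :: real assume x: "x \<noteq> 0" "0 < \<rho>"
    have "norm (orth_proj V (x /\<^sub>R norm x)) \<le> \<rho> / norm x \<longleftrightarrow> norm (orth_proj V x) \<le> \<rho>"
      if "V \<in> space \<gamma>" for V
    proof -
      have "norm (orth_proj V (x /\<^sub>R norm x)) = norm (orth_proj V x) / norm x"
        using that by (simp add: in_space_invariant_measure linear_scale[OF linear_orth_proj] divide_inverse_commute)
      then show ?thesis using x by (simp add: divide_le_cancel)
    qed
    then have "{V\<in>space \<gamma>. norm (orth_proj V x) \<le> \<rho>} =
        {V\<in>space \<gamma>. norm (orth_proj V (x /\<^sub>R norm x)) \<le> \<rho> / norm x}"
      by blast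
    then show "measure \<gamma> {V\<in>space \<gamma>. norm (orth_proj V x) \<le> \<rho>} \<le> C * (\<rho> / norm x) ^ m"
      using unit[of "x /\<^sub>R norm x" "\<rho> / norm x"] x by simp
  qed
qed

end

subsection \<open>The quasi-Assouad dimension\<close>

text \<open>For \<open>R < 1\<close> the bound \<open>R powr (1 / \<theta>)\<close> increases with
  \<open>\<theta>\<close>, so a larger \<open>\<theta>\<close> tests more pairs of radii and admits
  fewer exponents.\<close>

lemma upper_assouad_spectrum_mono:
  fixes F :: "(real ^ 'n) set"
  assumes "0 < \<theta>" "\<theta> \<le> \<theta>'" "\<theta>' < 1"
  shows "upper_assouad_spectrum \<theta> F \<le> upper_assouad_spectrum \<theta>' F"
  unfolding upper_assouad_spectrum_def
proof (rule Inf_superset_mono, rule subsetI)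
  fix z assume "z \<in> {ereal \<alpha> | \<alpha>. \<exists>C>0. \<forall>r R. \<forall>x\<in>F.
    0 < r \<and> r \<le> R powr (1 / \<theta>') \<and> R powr (1 / \<theta>') < R \<and> R < 1 \<longrightarrow>
    real (covering_number r (cball x R \<inter> F)) \<le> C * (R / r) powr \<alpha>}"
  then obtain \<alpha> C where \<alpha>: "z = ereal \<alpha>" "C > 0" and C: "\<And>r R x. x \<in> F \<Longrightarrow>
    0 < r \<and> r \<le> R powr (1 / \<theta>') \<and> R powr (1 / \<theta>') < R \<and> R < 1 \<Longrightarrow>
    real (covering_number r (cball x R \<inter> F)) \<le> C * (R / r) powr \<alpha>"
    by blast
  have "real (covering_number r (cball x R \<inter> F)) \<le> C * (R / r) powr \<alpha>"
    if "x \<in> F" "0 < r \<and> r \<le> R powr (1 / \<theta>) \<and> R powr (1 / \<theta>) < R \<and> R < 1" for r R x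
  proof (rule C[OF \<open>x \<in> F\<close>])
    have "0 < R" using that by (meson less_le_trans less_trans)
    moreover have "1 / \<theta>' \<le> 1 / \<theta>" "1 < 1 / \<theta>'" using assms by (auto simp: frac_le)
    ultimately have "R powr (1 / \<theta>) \<le> R powr (1 / \<theta>')" "R powr (1 / \<theta>') < R powr 1"
      using that powr_less_mono'[of R 1 "1 / \<theta>'"] powr_mono'[of "1 / \<theta>'" "1 / \<theta>" R] by auto
    then show "0 < r \<and> r \<le> R powr (1 / \<theta>') \<and> R powr (1 / \<theta>') < R \<and> R < 1"
      using that \<open>0 < R\<close> by simp
  qed
  then show "z \<in> {ereal \<alpha> | \<alpha>. \<exists>C>0. \<forall>r R. \<forall>x\<in>F.
    0 < r \<and> r \<le> R powr (1 / \<theta>) \<and> R powr (1 / \<theta>) < R \<and> R < 1 \<longrightarrow>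
    real (covering_number r (cball x R \<inter> F)) \<le> C * (R / r) powr \<alpha>}"
    using \<alpha> by blast
qed

lemma upper_assouad_spectrum_subset:
  fixes F :: "(real ^ 'n) set"
  assumes "G \<subseteq> F"
  shows "upper_assouad_spectrum \<theta> G \<le> upper_assouad_spectrum \<theta> F"
  unfolding upper_assouad_spectrum_def
proof (rule Inf_superset_mono, rule subsetI)
  fix z assume "z \<in> {ereal \<alpha> | \<alpha>. \<exists>C>0. \<forall>r R. \<forall>x\<in>F.
    0 < r \<and> r \<le> R powr (1 / \<theta>) \<and> R powr (1 / \<theta>) < R \<and> R < 1 \<longrightarrow>
    real (covering_number r (cball x R \<inter> F)) \<le> C * (R / r) powr \<alpha>}"
  then obtain \<alpha> C where \<alpha>: "z = ereal \<alpha>" "C > 0" and C: "\<And>r R x. x \<in> F \<Longrightarrow>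
    0 < r \<and> r \<le> R powr (1 / \<theta>) \<and> R powr (1 / \<theta>) < R \<and> R < 1 \<Longrightarrow>
    real (covering_number r (cball x R \<inter> F)) \<le> C * (R / r) powr \<alpha>"
    by blast
  have "real (covering_number r (cball x R \<inter> G)) \<le> C * (R / r) powr \<alpha>"
    if "x \<in> G" "0 < r \<and> r \<le> R powr (1 / \<theta>) \<and> R powr (1 / \<theta>) < R \<and> R < 1" for r R x
  proof -
    have "covering_number r (cball x R \<inter> G) \<le> covering_number r (cball x R \<inter> F)"
      using that assms by (intro covering_number_mono bounded_Int) auto
    then have "real (covering_number r (cball x R \<inter> G)) \<le> real (covering_number r (cball x R \<inter> F))"
      by simp
    also have "\<dots> \<le> C * (R / r) powr \<alpha>" using that assms by (intro C) auto
    finally show ?thesis .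
  qed
  then show "z \<in> {ereal \<alpha> | \<alpha>. \<exists>C>0. \<forall>r R. \<forall>x\<in>G.
    0 < r \<and> r \<le> R powr (1 / \<theta>) \<and> R powr (1 / \<theta>) < R \<and> R < 1 \<longrightarrow>
    real (covering_number r (cball x R \<inter> G)) \<le> C * (R / r) powr \<alpha>}"
    using \<alpha> by blast
qed

text \<open>\<open>Lim\<close> is a definite description, so its value is known only once
  convergence is proved. Monotonicity in \<open>\<theta>\<close> makes the left limit the
  supremum.\<close>

lemma quasi_assouad_dim_eq_SUP:
  fixes F :: "(real ^ 'n) set"
  shows "quasi_assouad_dim F = (SUP \<theta>\<in>{0<..<1}. upper_assouad_spectrum \<theta> F)"
proof -
  let ?f = "\<lambda>\<theta>. upper_assouad_spectrum \<theta> F"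
  have "(?f \<longlongrightarrow> (SUP \<theta>\<in>{0<..<1}. ?f \<theta>)) (at_left 1)"
  proof (rule order_tendstoI)
    fix a assume "a < (SUP \<theta>\<in>{0<..<1}. ?f \<theta>)"
    then obtain \<theta> where \<theta>: "0 < \<theta>" "\<theta> < 1" "a < ?f \<theta>" by (auto simp: less_SUP_iff)
    have "a < ?f \<theta>'" if "\<theta> < \<theta>'" "\<theta>' < 1" for \<theta>'
      using upper_assouad_spectrum_mono[of \<theta> \<theta>' F] \<theta> that by (simp add: less_le_trans)
    then show "\<forall>\<^sub>F \<theta> in at_left 1. a < ?f \<theta>"
      using \<theta>(2) by (auto simp: eventually_at_left_field)
  next
    fix a assume a: "(SUP \<theta>\<in>{0<..<1}. ?f \<theta>) < a"
    have "?f \<theta> < a" if "0 < \<theta>" "\<theta> < 1" for \<theta>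
      using a SUP_upper[of \<theta> "{0<..<1}" ?f] that by (simp add: le_less_trans)
    then show "\<forall>\<^sub>F \<theta> in at_left 1. ?f \<theta> < a"
      by (auto simp: eventually_at_left_field intro!: exI[of _ 0])
  qed
  then show ?thesis
    unfolding quasi_assouad_dim_def by (rule tendsto_Lim[rotated]) simp
qed

lemma quasi_assouad_dim_subset:
  fixes F :: "(real ^ 'n) set"
  assumes "G \<subseteq> F"
  shows "quasi_assouad_dim G \<le> quasi_assouad_dim F"
  unfolding quasi_assouad_dim_eq_SUP
  using upper_assouad_spectrum_subset[OF assms] by (rule SUP_mono')

text \<open>Some admissible exponent lies below \<open>a\<close>; raising it to \<open>a\<close>
  weakens the bound because \<open>R / r \<ge> 1\<close>.\<close>

lemma quasi_assouad_dim_less_imp_bound: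
  fixes F :: "(real ^ 'n) set"
  assumes "quasi_assouad_dim F < ereal a" "0 < \<theta>" "\<theta> < 1"
  obtains C where "0 < C" "\<And>r R x. x \<in> F \<Longrightarrow> 0 < r \<Longrightarrow> r \<le> R powr (1 / \<theta>) \<Longrightarrow> 0 < R \<Longrightarrow> R < 1 \<Longrightarrow>
    real (covering_number r (cball x R \<inter> F)) \<le> C * (R / r) powr a"
proof -
  have "upper_assouad_spectrum \<theta> F \<le> quasi_assouad_dim F"
    unfolding quasi_assouad_dim_eq_SUP using assms by (intro SUP_upper) auto
  then have "upper_assouad_spectrum \<theta> F < ereal a"
    using assms(1) by simp
  then have "\<exists>z\<in>{ereal \<alpha> | \<alpha>. \<exists>C>0. \<forall>r R. \<forall>x\<in>F.
    0 < r \<and> r \<le> R powr (1 / \<theta>) \<and> R powr (1 / \<theta>) < R \<and> R < 1 \<longrightarrow>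
    real (covering_number r (cball x R \<inter> F)) \<le> C * (R / r) powr \<alpha>}. z < ereal a"
    unfolding upper_assouad_spectrum_def Inf_less_iff .
  then obtain \<alpha> C where \<alpha>: "\<alpha> < a" "0 < C" and C: "\<forall>r R. \<forall>x\<in>F.
    0 < r \<and> r \<le> R powr (1 / \<theta>) \<and> R powr (1 / \<theta>) < R \<and> R < 1 \<longrightarrow>
    real (covering_number r (cball x R \<inter> F)) \<le> C * (R / r) powr \<alpha>"
    by (elim bexE CollectE exE conjE) simp
  show ?thesis
  proof (rule that[OF \<open>0 < C\<close>])
    fix r R x assume *: "x \<in> F" "0 < r" "r \<le> R powr (1 / \<theta>)" "0 < R" "R < 1"
    have R: "R powr (1 / \<theta>) < R"
      using powr_less_mono'[of R 1 "1 / \<theta>"] assms * by simp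
    then have "real (covering_number r (cball x R \<inter> F)) \<le> C * (R / r) powr \<alpha>"
      using * C by blast
    also have "\<dots> \<le> C * (R / r) powr a"
      using \<alpha> * R by (intro mult_left_mono powr_mono) auto
    finally show "real (covering_number r (cball x R \<inter> F)) \<le> C * (R / r) powr a" .
  qed
qed

text \<open>The restrictions \<open>r \<le> R powr (1 / \<theta>)\<close> and \<open>R < 1\<close>
  are traded for a factor \<open>r powr (- \<eta>)\<close>. A radius that is too small is replaced
  by \<open>r powr \<theta>\<close>, just large enough to be admissible; for a large radius
  boundedness leaves finitely many balls of radius \<open>1 / 2\<close>.\<close>

lemma quasi_assouad_dim_less_imp_uniform_bound:
  fixes F :: "(real ^ 'n) set"
  assumes qA: "quasi_assouad_dim F < ereal a" and "0 < a" "0 < \<eta>" and bdd: "bounded F"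
  obtains C where "0 < C" "\<And>r R x. x \<in> F \<Longrightarrow> 0 < r \<Longrightarrow> r \<le> R \<Longrightarrow> r \<le> 1 / 4 \<Longrightarrow>
    real (covering_number r (cball x R \<inter> F)) \<le> C * r powr (- \<eta>) * (R / r) powr a"
proof -
  \<comment> \<open>The second entry makes the loss \<open>(1 - \<theta>) * a\<close> at most
    \<open>\<eta>\<close>. The first gives \<open>(1 / 2) powr (1 / \<theta>) \<ge> 1 / 4\<close>,
    so radius \<open>1 / 2\<close> is admissible for every \<open>r \<le> 1 / 4\<close>.\<close>
  define \<theta> where "\<theta> = max (1 / 2) (1 - \<eta> / a)"
  have \<theta>: "1 / 2 \<le> \<theta>" "\<theta> < 1" and "1 - \<eta> / a \<le> \<theta>"
    using \<open>0 < a\<close> \<open>0 < \<eta>\<close> by (auto simp: \<theta>_def)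
  have "0 < \<theta>" using \<theta>(1) by simp
  have \<theta>a: "(1 - \<theta>) * a \<le> \<eta>" using \<open>0 < a\<close> \<open>1 - \<eta> / a \<le> \<theta>\<close> by (simp add: field_simps)
  obtain C where C: "0 < C" "\<And>r R x. x \<in> F \<Longrightarrow> 0 < r \<Longrightarrow> r \<le> R powr (1 / \<theta>) \<Longrightarrow> 0 < R \<Longrightarrow> R < 1 \<Longrightarrow>
    real (covering_number r (cball x R \<inter> F)) \<le> C * (R / r) powr a"
    by (rule quasi_assouad_dim_less_imp_bound[OF qA \<open>0 < \<theta>\<close> \<theta>(2)], rule that) blast+
  define L where "L = covering_number (1 / 2) F"
  have global: "real (covering_number r F) \<le> L * C * ((1 / 2) / r) powr a" if r: "0 < r" "r \<le> 1 / 4" for r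
  proof -
    obtain h :: "real ^ 'n \<Rightarrow> nat" where h: "h ` F \<subseteq> {..<L}"
      "\<And>x y. x \<in> F \<Longrightarrow> y \<in> F \<Longrightarrow> h x = h y \<Longrightarrow> dist x y \<le> 1 / 2"
      using covering_number_labelling[of "1 / 2" F] bdd unfolding L_def by auto
    have bd: "bounded {x\<in>F. h x = i}" for i
      using bdd by (rule bounded_subset) auto
    have "F = (\<Union>i\<in>{..<L}. {x\<in>F. h x = i})" using h(1) by auto
    then have "covering_number r F \<le> (\<Sum>i\<in>{..<L}. covering_number r {x\<in>F. h x = i})"
      using covering_number_UN_le[of r "{..<L}" "\<lambda>i. {x\<in>F. h x = i}"] r bd by simp
    then have "real (covering_number r F) \<le> (\<Sum>i\<in>{..<L}. real (covering_number r {x\<in>F. h x = i}))"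
      by (simp flip: of_nat_sum)
    also have "\<dots> \<le> (\<Sum>i\<in>{..<L}. C * ((1 / 2) / r) powr a)"
    proof (rule sum_mono)
      fix i
      show "real (covering_number r {x\<in>F. h x = i}) \<le> C * ((1 / 2) / r) powr a"
      proof (cases "{x\<in>F. h x = i} = {}")
        case True
        have "covering_number r {x\<in>F. h x = i} \<le> card ({} :: nat set)"
          using r True by (intro covering_number_le_card[where h = h]) auto
        then show ?thesis using C(1) by simp
      next
        case False
        then obtain w where w: "w \<in> F" "h w = i" by blast
        have "{x\<in>F. h x = i} \<subseteq> cball w (1 / 2) \<inter> F" using h(2)[of w] w by auto
        then have "covering_number r {x\<in>F. h x = i} \<le> covering_number r (cball w (1 / 2) \<inter> F)"
          using r by (intro covering_number_mono bounded_Int) auto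
        then have "real (covering_number r {x\<in>F. h x = i}) \<le> real (covering_number r (cball w (1 / 2) \<inter> F))"
          by simp
        also have "\<dots> \<le> C * ((1 / 2) / r) powr a"
        proof (rule C(2)[OF w(1)])
          have "(1 / 2 :: real) powr 2 \<le> (1 / 2) powr (1 / \<theta>)"
            using \<theta> by (intro powr_mono') (auto simp: field_simps)
          then show "r \<le> (1 / 2) powr (1 / \<theta>)" using r by (simp add: power2_eq_square)
        qed (use r in auto)
        finally show ?thesis .
      qed
    qed
    finally show ?thesis by simp
  qed
  show ?thesis
  proof (rule that[of "C * (L + 1)"])
    show "0 < C * (L + 1)" using C(1) by simp
    fix r R :: real and x assume *: "x \<in> F" "0 < r" "r \<le> R" "r \<le> 1 / 4"
    have r1: "1 \<le> r powr (- \<eta>)"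
      using * \<open>0 < \<eta>\<close> powr_mono'[of "- \<eta>" 0 r] by simp
    have Rr: "1 \<le> (R / r) powr a"
      using * \<open>0 < a\<close> by (intro ge_one_powr_ge_zero) auto
    have CL: "C \<le> C * (L + 1)" "L * C \<le> C * (L + 1)" using C(1) by (auto simp: algebra_simps)
    consider "1 / 2 \<le> R" | "R < 1 / 2" "r \<le> R powr (1 / \<theta>)" | "R powr (1 / \<theta>) < r"
      by linarith
    then show "real (covering_number r (cball x R \<inter> F)) \<le> C * (L + 1) * r powr (- \<eta>) * (R / r) powr a"
    proof cases
      case 1
      have "covering_number r (cball x R \<inter> F) \<le> covering_number r F"
        using * bdd by (intro covering_number_mono) auto
      then have "real (covering_number r (cball x R \<inter> F)) \<le> real (covering_number r F)" by simp
      also have "\<dots> \<le> L * C * ((1 / 2) / r) powr a" using * by (intro global) auto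
      also have "\<dots> \<le> (C * (L + 1)) * (R / r) powr a"
        using 1 * C(1) \<open>0 < a\<close> by (intro mult_mono[OF CL(2)] powr_mono2 divide_right_mono) auto
      also have "\<dots> \<le> C * (L + 1) * r powr (- \<eta>) * (R / r) powr a"
        using mult_left_mono[OF r1, of "C * (L + 1)"] C(1) by (intro mult_right_mono) auto
      finally show ?thesis .
    next
      case 2
      then have "real (covering_number r (cball x R \<inter> F)) \<le> C * (R / r) powr a"
        using * by (intro C(2)) auto
      also have "\<dots> \<le> (C * (L + 1)) * r powr (- \<eta>) * (R / r) powr a"
        using mult_mono[OF CL(1) r1] C(1) by (intro mult_right_mono) auto
      finally show ?thesis .
    next
      \<comment> \<open>The ball of radius \<open>r powr \<theta>\<close> costs
        \<open>r powr ((\<theta> - 1) * a)\<close> up to a constant, independently of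
        \<open>R\<close>.\<close>
      case 3
      have "R = (R powr (1 / \<theta>)) powr \<theta>" using \<theta> * by (simp add: powr_powr)
      also have "\<dots> \<le> r powr \<theta>" using 3 \<theta> by (intro powr_mono2) auto
      finally have R: "R \<le> r powr \<theta>" .
      have "covering_number r (cball x R \<inter> F) \<le> covering_number r (cball x (r powr \<theta>) \<inter> F)"
        using * R by (intro covering_number_mono bounded_Int) auto
      then have "real (covering_number r (cball x R \<inter> F)) \<le> real (covering_number r (cball x (r powr \<theta>) \<inter> F))"
        by simp
      also have "\<dots> \<le> C * (r powr \<theta> / r) powr a"
      proof (rule C(2))
        show "r \<le> (r powr \<theta>) powr (1 / \<theta>)" using * \<theta> by (simp add: powr_powr)
        show "r powr \<theta> < 1" using * \<theta> powr_less_mono'[of r 0 \<theta>] by simp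
      qed (use * in auto)
      also have "r powr \<theta> / r = r powr (\<theta> - 1)" using * by (simp add: powr_diff)
      also have "(r powr (\<theta> - 1)) powr a = r powr ((\<theta> - 1) * a)" by (simp add: powr_powr)
      also have "C * r powr ((\<theta> - 1) * a) \<le> C * r powr (- \<eta>)"
        using C(1) \<theta>a * by (intro mult_left_mono powr_mono') (auto simp: algebra_simps)
      also have "\<dots> = C * r powr (- \<eta>) * 1" by simp
      also have "\<dots> \<le> (C * (L + 1)) * r powr (- \<eta>) * (R / r) powr a"
        using CL C(1) Rr by (intro mult_mono mult_right_mono) auto
      finally show ?thesis .
    qed
  qed
qed

subsection \<open>Counting pairs of points with close projections\<close>

text \<open>Cauchy-Schwarz over the label classes: their sizes add up to \<open>card E\<close>, and
  the squares of their sizes count the collisions.\<close>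

lemma card_square_le_card_collisions:
  fixes h :: "'a \<Rightarrow> nat"
  assumes "finite E" "h ` E \<subseteq> {..<N}"
  shows "(real (card E))\<^sup>2 \<le> real N * real (card {(x, y) \<in> E \<times> E. h x = h y})"
proof -
  define A where "A l = {x\<in>E. h x = l}" for l
  have fin: "finite (A l)" for l using assms by (simp add: A_def)
  have disj: "i \<noteq> j \<Longrightarrow> A i \<inter> A j = {}" for i j by (auto simp: A_def)
  have E: "E = (\<Union>l\<in>{..<N}. A l)" using assms(2) by (auto simp: A_def)
  have "card E = (\<Sum>l<N. card (A l))"
    unfolding E using fin disj by (intro card_UN_disjoint) (auto simp: A_def)
  then have "(real (card E))\<^sup>2 = (\<Sum>l<N. real (card (A l)))\<^sup>2" by simp
  also have "\<dots> \<le> (\<Sum>l<N. (real (card (A l)))\<^sup>2) * card {..<N}"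
    by (rule sum_squared_le_sum_of_squares)
  also have "(\<Sum>l<N. (real (card (A l)))\<^sup>2) = real (\<Sum>l<N. card (A l \<times> A l))"
    by (simp add: power2_eq_square card_cartesian_product)
  also have "(\<Sum>l<N. card (A l \<times> A l)) = card (\<Union>l\<in>{..<N}. A l \<times> A l)"
    using fin disj by (intro card_UN_disjoint[symmetric]) auto
  also have "(\<Union>l\<in>{..<N}. A l \<times> A l) = {(x, y) \<in> E \<times> E. h x = h y}"
    using assms(2) by (auto simp: A_def)
  finally show ?thesis by (simp add: mult.commute)
qed

lemma ex_dyadic_scale:
  fixes d \<delta> :: real
  assumes "0 < \<delta>" "\<delta> \<le> d" "d \<le> 2 ^ K * \<delta>"
  obtains k where "k \<le> K" "2 ^ k * \<delta> \<le> d" "d \<le> 2 ^ (k + 1) * \<delta>"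
proof -
  define k where "k = (GREATEST k. k \<le> K \<and> 2 ^ k * \<delta> \<le> d)"
  have P0: "0 \<le> K \<and> 2 ^ 0 * \<delta> \<le> d" using assms by simp
  have k: "k \<le> K \<and> 2 ^ k * \<delta> \<le> d"
    unfolding k_def by (rule GreatestI_nat[of _ 0 K]) (use P0 in auto)
  have "d \<le> 2 ^ (k + 1) * \<delta>"
  proof (cases "k = K")
    case True
    have "2 ^ K * \<delta> \<le> 2 ^ (K + 1) * \<delta>" using assms by simp
    then show ?thesis using True assms by simp
  next
    case False
    show ?thesis
    proof (rule ccontr)
      assume "\<not> ?thesis"
      then have "k + 1 \<le> K \<and> 2 ^ (k + 1) * \<delta> \<le> d" using False k by auto
      then have "k + 1 \<le> k"
        unfolding k_def by (intro Greatest_le_nat[where b = K]) auto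
      then show False by simp
    qed
  qed
  then show ?thesis using that k by blast
qed

text \<open>A discrete Riesz-type sum. At distance about \<open>2 ^ k * \<delta>\<close> from
  \<open>x\<close> there are at most a multiple of \<open>(2 ^ k) powr a\<close> points, each
  contributing at most \<open>(1 / 2 ^ k) ^ m\<close>. Since \<open>m < a\<close> these bounds grow
  geometrically and the outermost scale \<open>K\<close> decides.\<close>

lemma sum_inverse_power_dist_le:
  fixes E F :: "(real ^ 'n) set"
  assumes E: "finite E" "E \<subseteq> F" "x \<in> E" and \<delta>: "0 < \<delta>"
    and sep: "\<And>x y. x \<in> E \<Longrightarrow> y \<in> E \<Longrightarrow> x \<noteq> y \<Longrightarrow> \<delta> \<le> dist x y"
    and diam: "\<And>y. y \<in> E \<Longrightarrow> dist x y \<le> 2 ^ K * \<delta>"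
    and cov: "\<And>R. \<delta> \<le> R \<Longrightarrow> real (covering_number (\<delta> / 2) (cball x R \<inter> F)) \<le> A * (R / (\<delta> / 2)) powr a"
    and "0 \<le> A" "real m < a"
  shows "(\<Sum>y\<in>E - {x}. (\<delta> / dist x y) ^ m) \<le> A * 4 powr a * 2 powr ((a - m) * (K + 1)) / (2 powr (a - m) - 1)"
proof -
  define q where "q = (2::real) powr (a - m)"
  have q: "1 < q" using \<open>real m < a\<close> by (simp add: q_def)
  \<comment> \<open>Radius \<open>2 ^ (k + 1) * \<delta>\<close> measured in units of
    \<open>\<delta> / 2\<close> is \<open>4 * 2 ^ k\<close>, whence \<open>4 powr a\<close>; the
    halved scale again makes the separation strict.\<close>
  have count: "real (card {y\<in>E. dist x y \<le> 2 ^ (k + 1) * \<delta>}) \<le> A * 4 powr a * (2 ^ k) powr a" for k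
  proof -
    let ?R = "2 ^ (k + 1) * \<delta>"
    have "\<delta> * 1 \<le> \<delta> * 2 ^ (k + 1)" using \<delta> by (intro mult_left_mono one_le_power) auto
    then have R: "\<delta> \<le> ?R" by (simp add: mult.commute)
    have "card {y\<in>E. dist x y \<le> ?R} \<le> covering_number (\<delta> / 2) (cball x ?R \<inter> F)"
    proof (rule card_separated_le_covering_number)
      show "{y\<in>E. dist x y \<le> ?R} \<subseteq> cball x ?R \<inter> F" using E by auto
      fix u v assume "u \<in> {y\<in>E. dist x y \<le> ?R}" "v \<in> {y\<in>E. dist x y \<le> ?R}" "u \<noteq> v"
      then show "\<delta> / 2 < dist u v" using sep[of u v] \<delta> by simp
    qed (use \<delta> in \<open>auto intro: bounded_Int\<close>)
    then have "real (card {y\<in>E. dist x y \<le> ?R}) \<le> real (covering_number (\<delta> / 2) (cball x ?R \<inter> F))"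
      by simp
    also have "\<dots> \<le> A * (?R / (\<delta> / 2)) powr a" using cov[OF R] .
    also have "?R / (\<delta> / 2) = 4 * 2 ^ k" using \<delta> by simp
    also have "A * (4 * 2 ^ k) powr a = A * 4 powr a * (2 ^ k) powr a"
      by (simp add: powr_mult)
    finally show ?thesis .
  qed
  have pw: "(1 / 2 ^ k) ^ m * (2 ^ k) powr a = q ^ k" for k
  proof -
    have "(1 / 2 ^ k) ^ m = (2::real) powr - (real k * real m)"
      by (simp add: powr_minus powr_realpow power_one_over power_mult power_inverse divide_inverse flip: of_nat_mult)
    moreover have "((2::real) ^ k) powr a = 2 powr (real k * a)"
      by (simp add: powr_powr flip: powr_realpow)
    ultimately have "(1 / 2 ^ k) ^ m * (2 ^ k) powr a = (2::real) powr (- (real k * real m) + real k * a)"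
      by (simp only: powr_add)
    also have "- (real k * real m) + real k * a = (a - m) * real k" by (simp add: algebra_simps)
    also have "2 powr ((a - m) * real k) = q ^ k"
      unfolding q_def by (simp add: powr_realpow flip: powr_powr)
    finally show ?thesis .
  qed
  \<comment> \<open>Balls replace annuli: each point is charged at its own dyadic scale, and the
    remaining terms are non-negative.\<close>
  have "(\<Sum>y\<in>E - {x}. (\<delta> / dist x y) ^ m) \<le>
      (\<Sum>y\<in>E - {x}. \<Sum>k\<le>K. (1 / 2 ^ k) ^ m * of_bool (dist x y \<le> 2 ^ (k + 1) * \<delta>))"
  proof (rule sum_mono)
    fix y assume y: "y \<in> E - {x}"
    then have d: "\<delta> \<le> dist x y" "dist x y \<le> 2 ^ K * \<delta>" using sep[of x y] diam[of y] E by auto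
    obtain k where k: "k \<le> K" "2 ^ k * \<delta> \<le> dist x y" "dist x y \<le> 2 ^ (k + 1) * \<delta>"
      using ex_dyadic_scale[OF \<delta> d] .
    have "\<delta> / dist x y \<le> 1 / 2 ^ k" using k(2) less_le_trans[OF \<delta> d(1)] by (simp add: field_simps)
    then have "(\<delta> / dist x y) ^ m \<le> (1 / 2 ^ k) ^ m * of_bool (dist x y \<le> 2 ^ (k + 1) * \<delta>)"
      using k(3) \<delta> by (simp add: power_mono del: power_one_over)
    also have "\<dots> \<le> (\<Sum>k\<le>K. (1 / 2 ^ k) ^ m * of_bool (dist x y \<le> 2 ^ (k + 1) * \<delta>))"
      by (rule member_le_sum) (use k(1) in auto)
    finally show "(\<delta> / dist x y) ^ m \<le> (\<Sum>k\<le>K. (1 / 2 ^ k) ^ m * of_bool (dist x y \<le> 2 ^ (k + 1) * \<delta>))" .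
  qed
  also have "\<dots> = (\<Sum>k\<le>K. \<Sum>y\<in>E - {x}. (1 / 2 ^ k) ^ m * of_bool (dist x y \<le> 2 ^ (k + 1) * \<delta>))"
    by (rule sum.swap)
  also have "\<dots> \<le> (\<Sum>k\<le>K. A * 4 powr a * q ^ k)"
  proof (rule sum_mono)
    fix k
    have "(\<Sum>y\<in>E - {x}. of_bool (dist x y \<le> 2 ^ (k + 1) * \<delta>)) = real (card {y\<in>E - {x}. dist x y \<le> 2 ^ (k + 1) * \<delta>})"
      using E by (simp add: sum_of_bool_eq Int_def conj_commute)
    also have "\<dots> \<le> real (card {y\<in>E. dist x y \<le> 2 ^ (k + 1) * \<delta>})"
      using E by (intro of_nat_mono card_mono) auto
    also note count[of k]
    finally have "(1 / 2 ^ k) ^ m * (\<Sum>y\<in>E - {x}. of_bool (dist x y \<le> 2 ^ (k + 1) * \<delta>)) \<le>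
        (1 / 2 ^ k) ^ m * (A * 4 powr a * (2 ^ k) powr a)"
      by (intro mult_left_mono) auto
    also have "\<dots> = A * 4 powr a * q ^ k" using pw[of k] by (simp add: ac_simps)
    finally show "(\<Sum>y\<in>E - {x}. (1 / 2 ^ k) ^ m * of_bool (dist x y \<le> 2 ^ (k + 1) * \<delta>)) \<le> A * 4 powr a * q ^ k"
      by (simp only: sum_distrib_left)
  qed
  also have "\<dots> = A * 4 powr a * ((q ^ (K + 1) - 1) / (q - 1))"
    using q by (simp only: geometric_sum lessThan_Suc_atMost[symmetric] Suc_eq_plus1 flip: sum_distrib_left)
  also have "\<dots> \<le> A * 4 powr a * (q ^ (K + 1) / (q - 1))"
    using q \<open>0 \<le> A\<close> by (intro mult_left_mono divide_right_mono) auto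
  also have "q ^ (K + 1) = 2 powr ((a - m) * (K + 1))"
    using q unfolding q_def by (subst powr_powr[symmetric], subst powr_realpow[symmetric]) auto
  finally show ?thesis by (simp add: q_def)
qed

text \<open>Indicators of events instead of a cardinality make the expectation a plain sum of
  probabilities. The diagonal is kept because Cauchy-Schwarz counts collisions in all of
  \<open>E \<times> E\<close>.\<close>

definition proj_pairs :: "(real ^ 'n) set measure \<Rightarrow> real \<Rightarrow> (real ^ 'n) set \<Rightarrow> (real ^ 'n) set \<Rightarrow> real"
  where "proj_pairs \<gamma> r E V = (\<Sum>x\<in>E. \<Sum>y\<in>E. indicator {V\<in>space \<gamma>. norm (orth_proj V (x - y)) \<le> r} V)"

context
  fixes m :: nat and \<gamma> :: "(real ^ 'n) set measure"
  assumes inv: "invariant_grassmannian_measure m \<gamma>"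
begin

lemma prob_space_invariant_measure: "prob_space \<gamma>"
  using inv by (simp add: invariant_grassmannian_measure_def)

lemma integral_proj_pairs:
  "integrable \<gamma> (proj_pairs \<gamma> r E)"
  "integral\<^sup>L \<gamma> (proj_pairs \<gamma> r E) = (\<Sum>x\<in>E. \<Sum>y\<in>E. measure \<gamma> {V\<in>space \<gamma>. norm (orth_proj V (x - y)) \<le> r})"
proof -
  interpret prob_space \<gamma> by (rule prob_space_invariant_measure)
  have int: "integrable \<gamma> (indicator {V\<in>space \<gamma>. norm (orth_proj V (x - y)) \<le> r} :: _ \<Rightarrow> real)" for x y
    using sets_small_proj[OF inv] by (simp add: less_top[symmetric])
  show "integrable \<gamma> (proj_pairs \<gamma> r E)"
    unfolding proj_pairs_def by (intro Bochner_Integration.integrable_sum int)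
  show "integral\<^sup>L \<gamma> (proj_pairs \<gamma> r E) = (\<Sum>x\<in>E. \<Sum>y\<in>E. measure \<gamma> {V\<in>space \<gamma>. norm (orth_proj V (x - y)) \<le> r})"
    unfolding proj_pairs_def
    using int sets_small_proj[OF inv]
    by (simp add: Bochner_Integration.integral_sum Bochner_Integration.integrable_sum Int_absorb2 sets.sets_into_space)
qed

text \<open>Points whose projections share a label form a close pair, so few close pairs force many
  labels.\<close>

lemma card_square_le_proj_pairs:
  assumes "finite E" "0 < r" "V \<in> space \<gamma>"
  shows "(real (card E))\<^sup>2 \<le> real (covering_number r (orth_proj V ` E)) * proj_pairs \<gamma> r E V"
proof -
  have V: "subspace V" using assms in_space_invariant_measure[OF inv] by blast
  obtain h :: "real ^ 'n \<Rightarrow> nat" where h: "h ` orth_proj V ` E \<subseteq> {..<covering_number r (orth_proj V ` E)}"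
    "\<And>x y. x \<in> orth_proj V ` E \<Longrightarrow> y \<in> orth_proj V ` E \<Longrightarrow> h x = h y \<Longrightarrow> dist x y \<le> r"
    using covering_number_labelling[OF \<open>0 < r\<close>, of "orth_proj V ` E"] assms(1) finite_imp_bounded by (metis finite_imageI)
  define g where "g x = h (orth_proj V x)" for x
  have "(real (card E))\<^sup>2 \<le> real (covering_number r (orth_proj V ` E)) * real (card {(x, y) \<in> E \<times> E. g x = g y})"
    using h(1) assms(1) by (intro card_square_le_card_collisions) (auto simp: g_def)
  also have "real (card {(x, y) \<in> E \<times> E. g x = g y}) = (\<Sum>x\<in>E. \<Sum>y\<in>E. of_bool (g x = g y))"
  proof -
    have "{(x, y) \<in> E \<times> E. g x = g y} = (SIGMA x:E. {y\<in>E. g x = g y})" by auto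
    then show ?thesis using assms(1) by (simp add: sum_of_bool_eq Int_def)
  qed
  also have "\<dots> \<le> proj_pairs \<gamma> r E V"
    unfolding proj_pairs_def
  proof (intro sum_mono)
    fix x y assume xy: "x \<in> E" "y \<in> E"
    have "norm (orth_proj V (x - y)) \<le> r" if "g x = g y"
      using h(2)[of "orth_proj V x" "orth_proj V y"] that xy
      by (simp add: g_def dist_norm linear_diff[OF linear_orth_proj[OF V]])
    then show "of_bool (g x = g y) \<le> (indicator {V\<in>space \<gamma>. norm (orth_proj V (x - y)) \<le> r} V :: real)"
      using assms(3) by (simp add: indicator_def)
  qed
  finally show ?thesis by (simp add: mult_left_mono)
qed

end

section \<open>Almost sure bounds at all small scales\<close>

lemma half_power_eq_powr: "(1 / 2 :: real) ^ j = 2 powr (- real j)"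
  by (simp add: powr_minus powr_realpow power_one_over inverse_eq_divide)

context
  fixes m :: nat and \<gamma> :: "(real ^ 'n) set measure"
  assumes inv: "invariant_grassmannian_measure m \<gamma>"
begin

text \<open>Row by row: for fixed \<open>x\<close> the diagonal term is at most 1, and the others
  are bounded by the small-projection estimate and summed by
  \<open>sum_inverse_power_dist_le\<close>. The extra exponent \<open>\<eta>\<close> is the loss in
  \<open>quasi_assouad_dim_less_imp_uniform_bound\<close>.\<close>

lemma expected_proj_pairs_le:
  fixes F :: "(real ^ 'n) set" and a \<eta> :: real
  assumes qA: "quasi_assouad_dim F < ereal a" and a: "real m < a" and \<eta>: "0 < \<eta>" and bdd: "bounded F"
  obtains D where "0 < D" "\<And>E j. E \<subseteq> F \<Longrightarrow> finite E \<Longrightarrow> 1 \<le> j \<Longrightarrow>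
    (\<And>x y. x \<in> E \<Longrightarrow> y \<in> E \<Longrightarrow> x \<noteq> y \<Longrightarrow> (1 / 2) ^ j \<le> dist x y) \<Longrightarrow>
    integral\<^sup>L \<gamma> (proj_pairs \<gamma> (4 * (1 / 2) ^ j) E) \<le> real (card E) * (D * 2 powr (j * (a - m + \<eta>)))"
proof -
  interpret prob_space \<gamma> by (rule prob_space_invariant_measure[OF inv])
  obtain c where c: "0 < c" "\<And>x \<rho>. x \<noteq> 0 \<Longrightarrow> 0 < \<rho> \<Longrightarrow>
    measure \<gamma> {V\<in>space \<gamma>. norm (orth_proj V x) \<le> \<rho>} \<le> c * (\<rho> / norm x) ^ m"
    by (rule measure_small_proj_le[OF inv], rule that) blast+
  have "0 < a" using a by simp
  obtain C where C: "0 < C" "\<And>r R x. x \<in> F \<Longrightarrow> 0 < r \<Longrightarrow> r \<le> R \<Longrightarrow> r \<le> 1 / 4 \<Longrightarrow>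
    real (covering_number r (cball x R \<inter> F)) \<le> C * r powr (- \<eta>) * (R / r) powr a"
    by (rule quasi_assouad_dim_less_imp_uniform_bound[OF qA \<open>0 < a\<close> \<eta> bdd], rule that) blast+
  \<comment> \<open>In units of \<open>\<delta> = (1 / 2) ^ j\<close> the diameter of
    \<open>F\<close> is at most \<open>2 ^ (L + j)\<close>, so the number of dyadic scales is
    \<open>j\<close> plus a constant.\<close>
  obtain L :: nat where L: "\<And>x y. x \<in> F \<Longrightarrow> y \<in> F \<Longrightarrow> dist x y \<le> 2 ^ L"
  proof -
    obtain L :: nat where "diameter F < 2 ^ L" using real_arch_pow[of 2 "diameter F"] by auto
    then show ?thesis
      using that[of L] diameter_bounded_bound[OF bdd] by (meson less_imp_le order_trans)
  qed
  define q where "q = (2::real) powr (a - m)"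
  have q: "1 < q" using a by (simp add: q_def)
  \<comment> \<open>\<open>c * 4 ^ m\<close> comes from small projections at radius
    \<open>4 * \<delta>\<close>, and \<open>2 powr \<eta>\<close> from the covering bound at
    \<open>\<delta> / 2\<close>. Of the top scale \<open>L + j + 1\<close> only \<open>L + 1\<close>
    enters here; the rest becomes \<open>2 powr (j * (a - m))\<close>.\<close>
  define D0 where "D0 = c * 4 ^ m * (C * 2 powr \<eta> * 4 powr a * 2 powr ((a - m) * (L + 1)) / (q - 1))"
  have D0: "0 < D0" using c(1) C(1) q by (simp add: D0_def)
  show ?thesis
  proof (rule that[of "1 + D0"])
    show "0 < 1 + D0" using D0 by simp
    fix E :: "(real ^ 'n) set" and j :: nat
    assume E: "E \<subseteq> F" "finite E" and j: "1 \<le> j"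
      and sep: "\<And>x y. x \<in> E \<Longrightarrow> y \<in> E \<Longrightarrow> x \<noteq> y \<Longrightarrow> (1 / 2) ^ j \<le> dist x y"
    define \<delta> :: real where "\<delta> = (1 / 2) ^ j"
    have \<delta>: "0 < \<delta>" "\<delta> / 2 \<le> 1 / 4" "2 ^ (L + j) * \<delta> = 2 ^ L"
    proof -
      have "\<delta> \<le> (1 / 2) ^ 1" unfolding \<delta>_def using j by (intro power_decreasing) auto
      then show "\<delta> / 2 \<le> 1 / 4" by simp
    qed (auto simp: \<delta>_def power_add power_one_over)
    have half: "(\<delta> / 2) powr (- \<eta>) = 2 powr \<eta> * 2 powr (j * \<eta>)"
    proof -
      have "\<delta> / 2 = 2 powr (- real (j + 1))"
        unfolding half_power_eq_powr[symmetric] by (simp add: \<delta>_def)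
      then have "(\<delta> / 2) powr (- \<eta>) = 2 powr (\<eta> + j * \<eta>)" by (simp add: powr_powr algebra_simps)
      then show ?thesis by (simp add: powr_add)
    qed
    have row: "(\<Sum>y\<in>E. measure \<gamma> {V\<in>space \<gamma>. norm (orth_proj V (x - y)) \<le> 4 * \<delta>})
        \<le> (1 + D0) * 2 powr (j * (a - m + \<eta>))" if x: "x \<in> E" for x
    proof -
      let ?p = "\<lambda>y. measure \<gamma> {V\<in>space \<gamma>. norm (orth_proj V (x - y)) \<le> 4 * \<delta>}"
      have "(\<Sum>y\<in>E. ?p y) = ?p x + (\<Sum>y\<in>E - {x}. ?p y)"
        using x E by (simp add: sum.remove)
      also have "\<dots> \<le> 1 + (\<Sum>y\<in>E - {x}. c * 4 ^ m * (\<delta> / dist x y) ^ m)"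
      proof (intro add_mono sum_mono prob_le_1)
        fix y assume "y \<in> E - {x}"
        then have "?p y \<le> c * (4 * \<delta> / norm (x - y)) ^ m"
          using \<delta> by (intro c(2)) auto
        then show "?p y \<le> c * 4 ^ m * (\<delta> / dist x y) ^ m"
          by (simp add: dist_norm power_mult_distrib power_divide)
      qed
      also have "(\<Sum>y\<in>E - {x}. c * 4 ^ m * (\<delta> / dist x y) ^ m) = c * 4 ^ m * (\<Sum>y\<in>E - {x}. (\<delta> / dist x y) ^ m)"
        by (simp only: sum_distrib_left)
      also have "\<dots> \<le> c * 4 ^ m * (C * (\<delta> / 2) powr (- \<eta>) * 4 powr a * 2 powr ((a - m) * (L + j + 1)) / (2 powr (a - m) - 1))"
      proof (intro mult_left_mono)
        show "(\<Sum>y\<in>E - {x}. (\<delta> / dist x y) ^ m) \<le>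
          C * (\<delta> / 2) powr (- \<eta>) * 4 powr a * 2 powr ((a - m) * (L + j + 1)) / (2 powr (a - m) - 1)"
        proof (rule sum_inverse_power_dist_le)
            fix y assume "y \<in> E"
            then show "dist x y \<le> 2 ^ (L + j) * \<delta>" using L x E \<delta>(3) by auto
          next
            fix R assume "\<delta> \<le> R"
            then show "real (covering_number (\<delta> / 2) (cball x R \<inter> F)) \<le> C * (\<delta> / 2) powr - \<eta> * (R / (\<delta> / 2)) powr a"
              using x E \<delta> by (intro C(2)) auto
          qed (use E x \<delta> sep C a in \<open>auto simp: \<delta>_def\<close>)
      qed (use c in auto)
      also have "\<dots> = D0 * 2 powr (j * (a - m + \<eta>))"
      proof -
        have "(a - m) * (L + j + 1) = (a - m) * (L + 1) + j * (a - m)" by (simp add: algebra_simps)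
        then have "2 powr ((a - m) * (L + j + 1)) = 2 powr ((a - m) * (L + 1)) * 2 powr (j * (a - m))"
          by (simp only: powr_add)
        moreover have "2 powr (j * (a - m + \<eta>)) = 2 powr (j * (a - m)) * 2 powr (j * \<eta>)"
          by (simp add: distrib_left powr_add)
        ultimately show ?thesis
          unfolding half D0_def q_def by (simp only: times_divide_eq_right times_divide_eq_left mult_ac)
      qed
      \<comment> \<open>Absorbs the diagonal term into the constant \<open>1 + D0\<close>.\<close>
      also have "1 \<le> 2 powr (j * (a - m + \<eta>))"
        using a \<eta> by (intro ge_one_powr_ge_zero) auto
      finally show ?thesis by (simp add: distrib_right)
    qed
    have "integral\<^sup>L \<gamma> (proj_pairs \<gamma> (4 * \<delta>) E) \<le> (\<Sum>x\<in>E. (1 + D0) * 2 powr (j * (a - m + \<eta>)))"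
      unfolding integral_proj_pairs[OF inv] by (intro sum_mono row)
    then show "integral\<^sup>L \<gamma> (proj_pairs \<gamma> (4 * (1 / 2) ^ j) E) \<le> real (card E) * ((1 + D0) * 2 powr (j * (a - m + \<eta>)))"
      by (simp add: \<delta>_def)
  qed
qed

text \<open>The inequality holds at every small scale and not merely along a sequence, which serves
  upper and lower box dimension alike. Markov's threshold exceeds the bound on the expectation by
  \<open>2 powr (j * (\<eta> / 2))\<close>, so the exceptional probabilities are summable.\<close>

lemma AE_covering_number_orth_proj_ge:
  fixes F :: "(real ^ 'n) set" and a \<eta> :: real
  assumes qA: "quasi_assouad_dim F < ereal a" and a: "real m < a" and \<eta>: "0 < \<eta>"
    and bdd: "bounded F" and "F \<noteq> {}"
  shows "AE V in \<gamma>. \<exists>c>0. \<exists>r0>0. \<forall>r. 0 < r \<and> r < r0 \<longrightarrow>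
    c * r powr (a - m + \<eta>) * real (covering_number r F) \<le> real (covering_number r (orth_proj V ` F))"
proof -
  interpret prob_space \<gamma> by (rule prob_space_invariant_measure[OF inv])
  define t where "t = a - m + \<eta>"
  have t: "0 < t" using a \<eta> by (simp add: t_def)
  \<comment> \<open>Half of \<open>\<eta>\<close> is spent on the expectation; the other half is the
    gain in Markov's inequality.\<close>
  obtain D where D: "0 < D" "\<And>E j. E \<subseteq> F \<Longrightarrow> finite E \<Longrightarrow> 1 \<le> j \<Longrightarrow>
    (\<And>x y. x \<in> E \<Longrightarrow> y \<in> E \<Longrightarrow> x \<noteq> y \<Longrightarrow> (1 / 2) ^ j \<le> dist x y) \<Longrightarrow>
    integral\<^sup>L \<gamma> (proj_pairs \<gamma> (4 * (1 / 2) ^ j) E) \<le> real (card E) * (D * 2 powr (j * (a - m + \<eta> / 2)))"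
    by (rule expected_proj_pairs_le[OF qA a half_gt_zero[OF \<eta>] bdd], rule that) blast+
  define \<delta> :: "nat \<Rightarrow> real" where "\<delta> j = (1 / 2) ^ j" for j
  have \<delta>: "0 < \<delta> j" for j by (simp add: \<delta>_def)
  have "\<forall>j. \<exists>E. E \<subseteq> F \<and> finite E \<and> (\<forall>x\<in>E. \<forall>y\<in>E. x \<noteq> y \<longrightarrow> \<delta> j \<le> dist x y) \<and>
      covering_number (2 * \<delta> j) F \<le> card E"
  proof
    fix j show "\<exists>E. E \<subseteq> F \<and> finite E \<and> (\<forall>x\<in>E. \<forall>y\<in>E. x \<noteq> y \<longrightarrow> \<delta> j \<le> dist x y) \<and>
      covering_number (2 * \<delta> j) F \<le> card E"
      by (rule exists_maximal_separated[OF \<delta>[of j] bdd]) blast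
  qed
  then obtain E where E: "\<And>j. E j \<subseteq> F" "\<And>j. finite (E j)"
    "\<And>j x y. x \<in> E j \<Longrightarrow> y \<in> E j \<Longrightarrow> x \<noteq> y \<Longrightarrow> \<delta> j \<le> dist x y"
    "\<And>j. covering_number (2 * \<delta> j) F \<le> card (E j)"
    by metis
  have card_pos: "0 < card (E j)" for j
    using E(4)[of j] covering_number_ge_1[of "2 * \<delta> j" F] \<delta>[of j] bdd \<open>F \<noteq> {}\<close> by simp
  define T where "T j = real (card (E j)) * D * 2 powr (j * t)" for j :: nat
  have T: "0 < T j" for j using card_pos D(1) by (simp add: T_def)
  define B where "B j = {V\<in>space \<gamma>. T j \<le> proj_pairs \<gamma> (4 * \<delta> j) (E j) V}" for j
  note [measurable] = borel_measurable_integrable[OF integral_proj_pairs(1)[OF inv]]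
  have sets_B: "B j \<in> sets \<gamma>" for j unfolding B_def by measurable
  have nonneg: "0 \<le> proj_pairs \<gamma> r A V" for r A V
    unfolding proj_pairs_def by (intro sum_nonneg) auto
  have prob_B: "measure \<gamma> (B j) \<le> (2 powr (- (\<eta> / 2))) ^ j" if "1 \<le> j" for j
  proof -
    have "measure \<gamma> (B j) \<le> integral\<^sup>L \<gamma> (proj_pairs \<gamma> (4 * \<delta> j) (E j)) / T j"
      unfolding B_def
      using integral_proj_pairs(1)[OF inv] T nonneg
      by (intro integral_Markov_inequality_measure[where A = "{}"]) auto
    also have "\<dots> \<le> real (card (E j)) * (D * 2 powr (j * (a - m + \<eta> / 2))) / T j"
      using T[of j] E that unfolding \<delta>_def by (intro divide_right_mono D(2)) auto
    also have "\<dots> = 2 powr (j * (a - m + \<eta> / 2)) / 2 powr (j * t)"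
      using card_pos[of j] D(1) by (simp add: T_def)
    also have "\<dots> = 2 powr (- (\<eta> / 2) * j)"
      by (simp add: t_def algebra_simps flip: powr_diff)
    also have "\<dots> = (2 powr (- (\<eta> / 2))) ^ j"
      by (subst powr_powr[symmetric], subst powr_realpow) auto
    finally show ?thesis .
  qed
  have "summable (\<lambda>j. measure \<gamma> (B j))"
  proof (rule summable_comparison_test')
    have "2 powr (- (\<eta> / 2)) < (1::real)" using \<eta> powr_less_mono[of "- (\<eta> / 2)" 0 2] by simp
    then show "summable (\<lambda>j. (2 powr (- (\<eta> / 2))) ^ j :: real)"
      by (intro summable_geometric) simp
    show "norm (measure \<gamma> (B j)) \<le> (2 powr (- (\<eta> / 2))) ^ j" if "1 \<le> j" for j
      using prob_B[OF that] by simp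
  qed
  then have "AE V in \<gamma>. \<forall>\<^sub>F j in sequentially. V \<in> space \<gamma> - B j"
    using sets_B by (intro borel_cantelli_AE1) (auto simp: less_top[symmetric])
  then show ?thesis
  proof (rule AE_mp, intro AE_I2 impI)
    fix V assume V: "V \<in> space \<gamma>" and "\<forall>\<^sub>F j in sequentially. V \<in> space \<gamma> - B j"
    then obtain J where J: "\<And>j. J \<le> j \<Longrightarrow> proj_pairs \<gamma> (4 * \<delta> j) (E j) V < T j"
      unfolding eventually_sequentially B_def by force
    have sub: "subspace V" using V in_space_invariant_measure[OF inv] by blast
    have bproj: "bounded (orth_proj V ` F)"
      using bounded_orth_proj_image[OF sub bdd] .
    show "\<exists>c>0. \<exists>r0>0. \<forall>r. 0 < r \<and> r < r0 \<longrightarrow>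
      c * r powr (a - m + \<eta>) * real (covering_number r F) \<le> real (covering_number r (orth_proj V ` F))"
    proof (intro exI conjI allI impI)
      \<comment> \<open>The constant comes from
        \<open>2 powr (- (j * t)) = \<delta> j powr t \<ge> (r / 4) powr t\<close> and does not
        depend on \<open>V\<close>; only the threshold \<open>2 * \<delta> J\<close> does.\<close>
      show "0 < 4 powr (- t) / D" using D(1) by simp
      show "0 < 2 * \<delta> J" using \<delta>[of J] by simp
      fix r assume r: "0 < r \<and> r < 2 * \<delta> J"
      \<comment> \<open>\<open>r < 2 * \<delta> J\<close> forces \<open>J < j\<close>, so
        \<open>j\<close> has a predecessor, and minimality yields
        \<open>2 * \<delta> j \<le> r \<le> 4 * \<delta> j\<close>.\<close>
      define j where "j = (LEAST j. 2 * \<delta> j \<le> r)"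
      have "\<exists>j. \<delta> j < r / 2"
        unfolding \<delta>_def using r by (intro real_arch_pow_inv) auto
      then have ex: "\<exists>j. 2 * \<delta> j \<le> r" by (auto simp: field_simps intro: less_imp_le)
      have jr: "2 * \<delta> j \<le> r" unfolding j_def using ex by (rule LeastI_ex)
      have "\<delta> j < \<delta> J" using jr r by simp
      then have "J < j" unfolding \<delta>_def
        by (rule contrapos_pp) (simp add: power_decreasing)
      then obtain i where i: "j = Suc i" by (cases j) auto
      have "\<not> 2 * \<delta> i \<le> r" using not_less_Least[of i "\<lambda>j. 2 * \<delta> j \<le> r"] i by (simp add: j_def)
      then have rj: "r \<le> 4 * \<delta> j" by (simp add: i \<delta>_def)
      define M where "M = real (card (E j))"
      define N where "N = real (covering_number (4 * \<delta> j) (orth_proj V ` E j))"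
      have M: "0 < M" using card_pos by (simp add: M_def)
      have "M * M \<le> N * proj_pairs \<gamma> (4 * \<delta> j) (E j) V"
        using card_square_le_proj_pairs[OF inv E(2)[of j] _ V, of "4 * \<delta> j"] \<delta>[of j]
        by (simp add: M_def N_def power2_eq_square)
      also have "\<dots> \<le> N * T j"
        using J[of j] \<open>J < j\<close> by (intro mult_left_mono) (auto simp: N_def)
      also have "\<dots> = (N * (D * 2 powr (j * t))) * M" by (simp add: T_def M_def)
      finally have MN: "M \<le> N * (D * 2 powr (j * t))" using M by simp
      have two: "4 powr (- t) * r powr t * 2 powr (j * t) \<le> 1"
      proof -
        have "4 powr (- t) * r powr t = (r / 4) powr t"
          using r by (simp add: powr_divide powr_minus_divide)
        also have "\<dots> \<le> \<delta> j powr t" using rj r t by (intro powr_mono2) auto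
        also have "\<delta> j = 2 powr (- real j)"
          by (simp add: \<delta>_def half_power_eq_powr)
        also have "(2 powr (- real j)) powr t = 2 powr (- (j * t))" by (simp add: powr_powr)
        finally have "4 powr (- t) * r powr t * 2 powr (j * t) \<le> 2 powr (- (j * t)) * 2 powr (j * t)"
          by (intro mult_right_mono) auto
        then show ?thesis by (simp add: powr_minus)
      qed
      have "real (covering_number r F) \<le> real (covering_number (2 * \<delta> j) F)"
        using jr \<delta>[of j] bdd by (simp add: covering_number_antimono)
      also have "\<dots> \<le> M" using E(4)[of j] by (simp add: M_def)
      finally have "4 powr (- t) / D * r powr t * real (covering_number r F) \<le>
          4 powr (- t) / D * r powr t * (N * (D * 2 powr (j * t)))"
        using MN D(1) by (intro mult_left_mono) auto
      also have "\<dots> = (4 powr (- t) * r powr t * 2 powr (j * t)) * N"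
        using D(1) by simp
      also have "\<dots> \<le> 1 * N" using two by (intro mult_right_mono) (auto simp: N_def)
      also have "1 * N \<le> real (covering_number (4 * \<delta> j) (orth_proj V ` F))"
        unfolding N_def using \<delta>[of j] bproj E(1) by (simp add: covering_number_mono image_mono)
      also have "\<dots> \<le> real (covering_number r (orth_proj V ` F))"
        using rj r bproj by (simp add: covering_number_antimono)
      finally show "4 powr (- t) / D * r powr (a - m + \<eta>) * real (covering_number r F) \<le>
          real (covering_number r (orth_proj V ` F))"
        by (simp add: t_def)
    qed
  qed
qed

end

subsection \<open>Box and packing dimensions\<close>

lemma eventually_at_right_0_ln:
  fixes B \<epsilon> :: real
  assumes "0 < \<epsilon>" "0 < r0"
  shows "\<forall>\<^sub>F r in at_right 0. 0 < r \<and> r < 1 \<and> r < r0 \<and> B \<le> \<epsilon> * (- ln r)"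
proof -
  have "\<forall>\<^sub>F r in at_right (0::real). 0 < r \<and> r < 1 \<and> r < r0 \<and> r < exp (- (B / \<epsilon>))"
    unfolding eventually_at_right_field
    using assms by (intro exI[of _ "min 1 (min r0 (exp (- (B / \<epsilon>))))"]) auto
  then show ?thesis
  proof eventually_elim
    case (elim r)
    then have "ln r < - (B / \<epsilon>)" using ln_less_cancel_iff[of r "exp (- (B / \<epsilon>))"] by simp
    then have "B / \<epsilon> \<le> - ln r" by simp
    then show ?case using assms elim by (simp add: field_simps)
  qed
qed

text \<open>After taking logarithms and dividing by \<open>- ln r\<close>, the factor
  \<open>r powr t\<close> costs \<open>t\<close>, and \<open>ln c\<close> disappears in an
  arbitrarily small \<open>\<epsilon>\<close>.\<close>

lemma box_dim_ge_minus:
  fixes E E' :: "(real ^ 'n) set" and t :: real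
  assumes E: "bounded E" "E \<noteq> {}" "bounded E'" "E' \<noteq> {}" and c: "0 < c" "0 < r0"
    and le: "\<And>r. 0 < r \<Longrightarrow> r < r0 \<Longrightarrow> c * r powr t * real (covering_number r E) \<le> real (covering_number r E')"
  shows "upper_box_dim E - ereal t \<le> upper_box_dim E'" "lower_box_dim E - ereal t \<le> lower_box_dim E'"
proof -
  let ?f = "\<lambda>r. ereal (ln (real (covering_number r E)) / (- ln r))"
  let ?g = "\<lambda>r. ereal (ln (real (covering_number r E')) / (- ln r))"
  have ev: "\<forall>\<^sub>F r in at_right 0. ?f r \<le> ?g r + ereal (t + \<epsilon>)" if "0 < \<epsilon>" for \<epsilon>
    using eventually_at_right_0_ln[OF that c(2), of "- ln c"]
  proof eventually_elim
    case (elim r)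
    have N: "1 \<le> real (covering_number r E)" "1 \<le> real (covering_number r E')"
      using covering_number_ge_1[of r E] covering_number_ge_1[of r E'] E elim by auto
    have "ln (c * r powr t * real (covering_number r E)) \<le> ln (real (covering_number r E'))"
      using le[of r] elim N c by (subst ln_le_cancel_iff) auto
    moreover have "ln (c * r powr t * real (covering_number r E)) = ln c + t * ln r + ln (real (covering_number r E))"
      using c elim N by (simp add: ln_mult ln_powr)
    ultimately have "ln (real (covering_number r E)) \<le> ln (real (covering_number r E')) + (t + \<epsilon>) * (- ln r)"
      using elim by (simp add: algebra_simps)
    moreover have "0 < - ln r" using elim by simp
    ultimately have "ln (real (covering_number r E)) / (- ln r) \<le> ln (real (covering_number r E')) / (- ln r) + (t + \<epsilon>)"
      by (simp add: field_simps)
    then show ?case by simp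
  qed
  have "upper_box_dim E \<le> upper_box_dim E' + ereal t + ereal \<epsilon>" if "0 < \<epsilon>" for \<epsilon>
  proof -
    have "upper_box_dim E \<le> Limsup (at_right 0) (\<lambda>r. ?g r + ereal (t + \<epsilon>))"
      unfolding upper_box_dim_def by (rule Limsup_mono[OF ev[OF that]])
    also have "\<dots> = upper_box_dim E' + ereal (t + \<epsilon>)"
      unfolding upper_box_dim_def by (rule Limsup_add_ereal_right) auto
    finally show ?thesis by (simp add: add.assoc)
  qed
  moreover have "lower_box_dim E \<le> lower_box_dim E' + ereal t + ereal \<epsilon>" if "0 < \<epsilon>" for \<epsilon>
  proof -
    have "lower_box_dim E \<le> Liminf (at_right 0) (\<lambda>r. ?g r + ereal (t + \<epsilon>))"
      unfolding lower_box_dim_def by (rule Liminf_mono[OF ev[OF that]])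
    also have "\<dots> = lower_box_dim E' + ereal (t + \<epsilon>)"
      unfolding lower_box_dim_def by (rule Liminf_add_ereal_right) auto
    finally show ?thesis by (simp add: add.assoc)
  qed
  ultimately have "upper_box_dim E \<le> upper_box_dim E' + ereal t" "lower_box_dim E \<le> lower_box_dim E' + ereal t"
    by (auto intro: ereal_le_epsilon2)
  then show "upper_box_dim E - ereal t \<le> upper_box_dim E'" "lower_box_dim E - ereal t \<le> lower_box_dim E'"
    by (simp_all add: ereal_minus_le)
qed

lemma box_dim_mono_covering:
  fixes E E' :: "(real ^ 'n) set"
  assumes "bounded E" "E \<noteq> {}" "bounded E'" "E' \<noteq> {}"
    and "\<And>r. 0 < r \<Longrightarrow> covering_number r E \<le> covering_number r E'"
  shows "upper_box_dim E \<le> upper_box_dim E'" "lower_box_dim E \<le> lower_box_dim E'"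
  using box_dim_ge_minus[OF assms(1-4), of 1 1 0] assms(5) by simp_all

lemma lower_box_dim_le_upper_box_dim: "lower_box_dim E \<le> upper_box_dim E"
  unfolding lower_box_dim_def upper_box_dim_def by (rule Liminf_le_Limsup) simp

lemma upper_box_dim_mono:
  fixes E E' :: "(real ^ 'n) set"
  assumes "bounded E'" "E \<noteq> {}" "E \<subseteq> E'"
  shows "upper_box_dim E \<le> upper_box_dim E'"
  using assms by (intro box_dim_mono_covering covering_number_mono) (auto intro: bounded_subset)

lemma upper_box_dim_closure_le:
  fixes E :: "(real ^ 'n) set"
  assumes "bounded E" "E \<noteq> {}"
  shows "upper_box_dim (closure E) \<le> upper_box_dim E"
  using assms by (intro box_dim_mono_covering covering_number_closure_le) (auto simp: closure_eq_empty)

lemma box_dim_orth_proj_le: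
  fixes F V :: "(real ^ 'n) set"
  assumes "subspace V" "bounded F" "F \<noteq> {}"
  shows "upper_box_dim (orth_proj V ` F) \<le> upper_box_dim F" "lower_box_dim (orth_proj V ` F) \<le> lower_box_dim F"
proof -
  have "bounded (orth_proj V ` F)"
    using bounded_orth_proj_image[OF assms(1,2)] .
  then show "upper_box_dim (orth_proj V ` F) \<le> upper_box_dim F" "lower_box_dim (orth_proj V ` F) \<le> lower_box_dim F"
    using assms dist_orth_proj_le by (auto intro!: box_dim_mono_covering covering_number_image_le)
qed

lemma upper_box_dim_le_dim_subspace:
  fixes E V :: "(real ^ 'n) set"
  assumes "subspace V" "E \<subseteq> V" "bounded E" "E \<noteq> {}"
  shows "upper_box_dim E \<le> ereal (dim V)"
proof -
  obtain R where R: "0 < R" "E \<subseteq> cball 0 R" using bounded_pos[of E] assms(3) by (auto simp: subset_iff)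
  \<comment> \<open>The final 2 absorbs the additive 2 of the grid bound, since
    \<open>2 \<le> 2 / r\<close> for \<open>r < 1\<close>.\<close>
  define K where "K = 2 * R * (real (dim V) + 1) + 2"
  have K: "0 < K" using R by (simp add: K_def add_pos_pos)
  have ev: "\<forall>\<^sub>F r in at_right 0. ereal (ln (real (covering_number r E)) / (- ln r)) \<le> ereal (dim V) + ereal \<epsilon>"
    if "0 < \<epsilon>" for \<epsilon>
    using eventually_at_right_0_ln[OF that zero_less_one, of "dim V * ln K"]
  proof eventually_elim
    case (elim r)
    have "covering_number r E \<le> covering_number r (V \<inter> cball 0 R)"
      using elim assms R by (intro covering_number_mono bounded_Int) auto
    then have "real (covering_number r E) \<le> real (covering_number r (V \<inter> cball 0 R))" by simp
    also have "\<dots> \<le> (2 * R * (real (dim V) + 1) / r + 2) ^ dim V"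
      using elim R assms by (intro covering_number_subspace_le) auto
    also have "\<dots> \<le> (K / r) ^ dim V"
    proof (rule power_mono)
      have "2 \<le> 2 / r" using elim by (simp add: pos_le_divide_eq)
      then show "2 * R * (real (dim V) + 1) / r + 2 \<le> K / r" by (simp add: K_def add_divide_distrib)
      show "0 \<le> 2 * R * (real (dim V) + 1) / r + 2" using elim R by simp
    qed
    finally have le: "real (covering_number r E) \<le> (K / r) ^ dim V" .
    have "1 \<le> real (covering_number r E)" using covering_number_ge_1[of r E] elim assms by simp
    then have "ln (real (covering_number r E)) \<le> ln ((K / r) ^ dim V)"
      using le K elim by (subst ln_le_cancel_iff) auto
    also have "\<dots> = dim V * ln K + dim V * (- ln r)"
      using K elim by (simp add: ln_realpow ln_div algebra_simps)
    also have "\<dots> \<le> (dim V + \<epsilon>) * (- ln r)" using elim by (simp add: algebra_simps)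
    finally have "ln (real (covering_number r E)) \<le> (dim V + \<epsilon>) * (- ln r)" .
    moreover have "0 < - ln r" using elim by simp
    ultimately have "ln (real (covering_number r E)) / (- ln r) \<le> dim V + \<epsilon>"
      by (simp only: pos_divide_le_eq)
    then show ?case by simp
  qed
  have "upper_box_dim E \<le> ereal (dim V) + ereal \<epsilon>" if "0 < \<epsilon>" for \<epsilon>
    unfolding upper_box_dim_def by (rule Limsup_bounded[OF ev[OF that]])
  then show ?thesis by (rule ereal_le_epsilon2)
qed

lemma upper_box_dim_less_infinity:
  fixes E :: "(real ^ 'n) set"
  assumes "bounded E" "E \<noteq> {}"
  shows "upper_box_dim E < \<infinity>"
  using upper_box_dim_le_dim_subspace[OF subspace_UNIV _ assms] by (auto simp: le_less_trans)

context
  fixes m :: nat and \<gamma> :: "(real ^ 'n) set measure"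
  assumes inv: "invariant_grassmannian_measure m \<gamma>"
begin

lemma AE_box_dim_orth_proj_ge:
  fixes F :: "(real ^ 'n) set"
  assumes "bounded F" "F \<noteq> {}"
  shows "AE V in \<gamma>. upper_box_dim F - max 0 (quasi_assouad_dim F - ereal m) \<le> upper_box_dim (orth_proj V ` F) \<and>
    lower_box_dim F - max 0 (quasi_assouad_dim F - ereal m) \<le> lower_box_dim (orth_proj V ` F)"
proof (cases "quasi_assouad_dim F = \<infinity>")
  case True
  \<comment> \<open>In \<open>ereal\<close> the difference \<open>\<infinity> - \<infinity>\<close>
    is \<open>\<infinity>\<close>. With box dimensions below \<open>\<infinity>\<close> the asserted
    lower bounds are \<open>-\<infinity>\<close>.\<close>
  have "upper_box_dim F \<noteq> \<infinity>" "lower_box_dim F \<noteq> \<infinity>"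
    using upper_box_dim_less_infinity[OF assms] lower_box_dim_le_upper_box_dim[of F] by auto
  then have "upper_box_dim F - \<infinity> = -\<infinity>" "lower_box_dim F - \<infinity> = -\<infinity>"
    by (cases "upper_box_dim F"; cases "lower_box_dim F"; simp)+
  then show ?thesis using True by (simp add: max_def)
next
  case False
  define c where "c = real_of_ereal (max 0 (quasi_assouad_dim F - ereal m))"
  have c: "max 0 (quasi_assouad_dim F - ereal m) = ereal c" "0 \<le> c"
    using False by (cases "quasi_assouad_dim F"; auto simp: c_def max_def)+
  have qA: "quasi_assouad_dim F < ereal (m + c + \<epsilon>)" if "0 < \<epsilon>" for \<epsilon>
    using False c that by (cases "quasi_assouad_dim F") (auto simp: max_def split: if_splits)
  \<comment> \<open>Both \<open>a - (m + c)\<close> and \<open>\<eta>\<close> are taken as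
    \<open>1 / (k + 1)\<close>: countably many null sets, and a total loss of
    \<open>c + 2 / (k + 1)\<close>.\<close>
  have "AE V in \<gamma>. \<forall>k::nat. \<exists>b>0. \<exists>r0>0. \<forall>r. 0 < r \<and> r < r0 \<longrightarrow>
    b * r powr ((m + c + 1 / (k + 1)) - m + 1 / (k + 1)) * real (covering_number r F) \<le> real (covering_number r (orth_proj V ` F))"
    unfolding AE_all_countable
    using assms c(2) by (intro allI AE_covering_number_orth_proj_ge[OF inv] qA) (auto simp: add_nonneg_pos)
  then show ?thesis
  proof (rule AE_mp, intro AE_I2 impI)
    fix V assume V: "V \<in> space \<gamma>" and *: "\<forall>k::nat. \<exists>b>0. \<exists>r0>0. \<forall>r. 0 < r \<and> r < r0 \<longrightarrow>
      b * r powr ((m + c + 1 / (k + 1)) - m + 1 / (k + 1)) * real (covering_number r F) \<le> real (covering_number r (orth_proj V ` F))"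
    have sub: "subspace V" using V in_space_invariant_measure[OF inv] by blast
    have bproj: "bounded (orth_proj V ` F)"
      using bounded_orth_proj_image[OF sub assms(1)] .
    have ineq: "upper_box_dim F \<le> upper_box_dim (orth_proj V ` F) + ereal c + ereal \<epsilon> \<and>
        lower_box_dim F \<le> lower_box_dim (orth_proj V ` F) + ereal c + ereal \<epsilon>" if \<epsilon>: "0 < \<epsilon>" for \<epsilon>
    proof -
      obtain k :: nat where k: "1 / (k + 1) < \<epsilon> / 2" using \<epsilon> nat_approx_posE[of "\<epsilon> / 2"] by auto
      obtain b r0 where b: "0 < b" "0 < r0" "\<And>r. 0 < r \<Longrightarrow> r < r0 \<Longrightarrow>
         b * r powr ((m + c + 1 / (k + 1)) - m + 1 / (k + 1)) * real (covering_number r F) \<le> real (covering_number r (orth_proj V ` F))"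
        using * by metis
      have "orth_proj V ` F \<noteq> {}" using assms by simp
      note box = box_dim_ge_minus[OF assms bproj this b]
      have le: "ereal ((m + c + 1 / (k + 1)) - m + 1 / (k + 1)) \<le> ereal c + ereal \<epsilon>" using k by simp
      show ?thesis
        using box le by (auto simp: ereal_minus_le add.assoc intro: order_trans[OF _ add_left_mono])
    qed
    then have "upper_box_dim F \<le> upper_box_dim (orth_proj V ` F) + ereal c"
      "lower_box_dim F \<le> lower_box_dim (orth_proj V ` F) + ereal c"
      by (auto intro: ereal_le_epsilon2)
    then show "upper_box_dim F - max 0 (quasi_assouad_dim F - ereal m) \<le> upper_box_dim (orth_proj V ` F) \<and>
      lower_box_dim F - max 0 (quasi_assouad_dim F - ereal m) \<le> lower_box_dim (orth_proj V ` F)"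
      unfolding c by (simp add: ereal_minus_le)
  qed
qed

end

section \<open>Basic properties of packing dimension\<close>

lemma packing_dim_mono:
  fixes A B :: "(real ^ 'n) set"
  assumes "A \<subseteq> B"
  shows "packing_dim A \<le> packing_dim B"
  unfolding packing_dim_def using assms by (intro Inf_superset_mono) blast

lemma packing_dim_le:
  assumes "\<And>j :: nat. compact (K j)" "\<And>j. K j \<noteq> {}" "A \<subseteq> (\<Union>j. K j)" "\<And>j. upper_box_dim (K j) \<le> s"
  shows "packing_dim A \<le> s"
proof -
  have "packing_dim A \<le> (SUP j. upper_box_dim (K j))"
    unfolding packing_dim_def using assms by (intro Inf_lower) blast
  also have "\<dots> \<le> s" using assms(4) by (intro SUP_least) auto
  finally show ?thesis .
qed

lemma packing_dim_less_imp_cover: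
  fixes A :: "(real ^ 'n) set"
  assumes "packing_dim A < s"
  shows "\<exists>K :: nat \<Rightarrow> (real ^ 'n) set. (\<forall>j. compact (K j)) \<and> (\<forall>j. K j \<noteq> {}) \<and> A \<subseteq> (\<Union>j. K j) \<and>
    (\<forall>j. upper_box_dim (K j) \<le> s)"
proof -
  obtain z where z: "z \<in> {(SUP j. upper_box_dim (K j)) | K :: nat \<Rightarrow> (real ^ 'n) set.
    (\<forall>j. compact (K j) \<and> K j \<noteq> {}) \<and> A \<subseteq> (\<Union>j. K j)}" "z < s"
    using assms unfolding packing_dim_def Inf_less_iff by (elim bexE)
  from z(1) obtain K :: "nat \<Rightarrow> (real ^ 'n) set" where K: "z = (SUP j. upper_box_dim (K j))"
    "\<forall>j. compact (K j) \<and> K j \<noteq> {}" "A \<subseteq> (\<Union>j. K j)"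
    by (elim CollectE exE conjE)
  have "upper_box_dim (K j) \<le> s" for j
  proof -
    have "upper_box_dim (K j) \<le> z" unfolding K(1) by (rule SUP_upper) simp
    then show ?thesis using z(2) by simp
  qed
  then show ?thesis using K by blast
qed

text \<open>Near-optimal covers of the members are merged into one sequence by
  \<open>prod_decode\<close>; the slack \<open>z > s\<close> is there because an infimum need not be
  attained. The empty family is excluded since \<open>s\<close> may be negative.\<close>

lemma packing_dim_Union_le:
  fixes \<A> :: "(real ^ 'n) set set"
  assumes "countable \<A>" "\<A> \<noteq> {}" "\<And>A. A \<in> \<A> \<Longrightarrow> packing_dim A \<le> s"
  shows "packing_dim (\<Union>\<A>) \<le> s"
proof (rule dense_ge)
  fix z assume "s < z"
  define A where "A = from_nat_into \<A>"
  have A: "\<Union>\<A> = (\<Union>i. A i)" "\<And>i. A i \<in> \<A>"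
    using range_from_nat_into[OF assms(2,1)] unfolding A_def by blast+
  have "\<exists>K :: nat \<Rightarrow> (real ^ 'n) set. (\<forall>j. compact (K j)) \<and> (\<forall>j. K j \<noteq> {}) \<and> A i \<subseteq> (\<Union>j. K j) \<and> (\<forall>j. upper_box_dim (K j) \<le> z)" for i
    by (rule packing_dim_less_imp_cover[OF le_less_trans[OF assms(3)[OF A(2)] \<open>s < z\<close>]])
  then obtain K :: "nat \<Rightarrow> nat \<Rightarrow> (real ^ 'n) set" where K: "\<And>i j. compact (K i j)" "\<And>i j. K i j \<noteq> {}"
    "\<And>i. A i \<subseteq> (\<Union>j. K i j)" "\<And>i j. upper_box_dim (K i j) \<le> z"
    by metis
  show "packing_dim (\<Union>\<A>) \<le> z"
  proof (rule packing_dim_le[where K = "\<lambda>n. K (fst (prod_decode n)) (snd (prod_decode n))"])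
    show "\<Union>\<A> \<subseteq> (\<Union>n. K (fst (prod_decode n)) (snd (prod_decode n)))"
    proof
      fix x assume "x \<in> \<Union>\<A>"
      then obtain i j where "x \<in> K i j" using A(1) K(3) by blast
      then have "x \<in> K (fst (prod_decode (prod_encode (i, j)))) (snd (prod_decode (prod_encode (i, j))))" by simp
      then show "x \<in> (\<Union>n. K (fst (prod_decode n)) (snd (prod_decode n)))" by blast
    qed
  qed (simp_all add: K(1,2,4))
qed

lemma packing_dim_le_upper_box_dim:
  fixes E :: "(real ^ 'n) set"
  assumes "bounded E" "E \<noteq> {}"
  shows "packing_dim E \<le> upper_box_dim E"
  using assms upper_box_dim_closure_le[OF assms] closure_subset[of E]
  by (intro packing_dim_le[where K = "\<lambda>_. closure E"]) auto

lemma packing_dim_le_dim_subspace: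
  fixes A V :: "(real ^ 'n) set"
  assumes "subspace V" "A \<subseteq> V"
  shows "packing_dim A \<le> ereal (dim V)"
proof (rule packing_dim_le[where K = "\<lambda>j. V \<inter> cball 0 (real j)"])
  show "A \<subseteq> (\<Union>j. V \<inter> cball 0 (real j))"
    using assms(2) real_arch_simple by auto
  fix j
  have "closed V" using assms(1) by (rule closed_subspace)
  then show "compact (V \<inter> cball 0 (real j))" by (intro closed_Int_compact compact_cball)
  show ne: "V \<inter> cball 0 (real j) \<noteq> {}" using subspace_0[OF assms(1)] by auto
  then show "upper_box_dim (V \<inter> cball 0 (real j)) \<le> ereal (dim V)"
    using assms by (intro upper_box_dim_le_dim_subspace) (auto intro: bounded_Int)
qed

lemma packing_dim_less_infinity: "packing_dim A < \<infinity>"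
  using packing_dim_le_dim_subspace[OF subspace_UNIV, of A] by (auto simp: le_less_trans)

lemma packing_dim_orth_proj_le:
  fixes F V :: "(real ^ 'n) set"
  assumes "subspace V"
  shows "packing_dim (orth_proj V ` F) \<le> packing_dim F"
proof (rule dense_ge)
  fix z assume lt: "packing_dim F < z"
  obtain K :: "nat \<Rightarrow> (real ^ 'n) set" where K: "\<And>j. compact (K j)" "\<And>j. K j \<noteq> {}" "F \<subseteq> (\<Union>j. K j)"
    "\<And>j. upper_box_dim (K j) \<le> z"
    using packing_dim_less_imp_cover[OF lt] by metis
  show "packing_dim (orth_proj V ` F) \<le> z"
  proof (rule packing_dim_le[where K = "\<lambda>j. orth_proj V ` K j"])
    fix j
    show "compact (orth_proj V ` K j)" by (intro compact_continuous_image continuous_on_orth_proj assms K)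
    show "upper_box_dim (orth_proj V ` K j) \<le> z"
      using box_dim_orth_proj_le(1)[OF assms compact_imp_bounded[OF K(1)[of j]] K(2)[of j]] K(4)[of j] by simp
    show "orth_proj V ` F \<subseteq> (\<Union>j. orth_proj V ` K j)" using K(3) by blast
    show "orth_proj V ` K j \<noteq> {}" using K(2) by simp
  qed
qed

subsection \<open>Analytic sets\<close>

text \<open>The space of real sequences takes the role of the Baire space in the usual definition
  of analytic sets, since the discrete type \<^typ>\<open>nat\<close> carries no metric.\<close>

definition analytic_set :: "'a :: metric_space set \<Rightarrow> bool"
  where "analytic_set A \<longleftrightarrow> (\<exists>C :: ('a \<times> (nat \<Rightarrow> real)) set. closed C \<and> A = fst ` C)"

lemma continuous_reindex:
  "continuous_on UNIV (\<lambda>p :: 'a :: metric_space \<times> (nat \<Rightarrow> real). (fst p, \<lambda>n. snd p (g n)))"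
  by (intro continuous_on_Pair continuous_on_fst continuous_on_id continuous_on_coordinatewise_then_product
      continuous_on_compose2[OF continuous_on_product_coordinates continuous_on_snd[OF continuous_on_id]]) auto

lemma continuous_coordinate:
  "continuous_on UNIV (\<lambda>p :: 'a :: metric_space \<times> (nat \<Rightarrow> real). snd p k)"
  by (intro continuous_on_compose2[OF continuous_on_product_coordinates continuous_on_snd[OF continuous_on_id]]) auto

lemma analytic_set_closed:
  assumes "closed A"
  shows "analytic_set A"
  unfolding analytic_set_def
proof (intro exI conjI)
  show "closed (A \<times> (UNIV :: (nat \<Rightarrow> real) set))" using assms by (intro closed_Times) auto
  show "A = fst ` (A \<times> (UNIV :: (nat \<Rightarrow> real) set))" by auto
qed

text \<open>The equation defining \<open>C\<close> asks coordinate 0 to be the reciprocal of the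
  distance to the complement. It is solvable exactly over \<open>A\<close> and is closed by
  continuity.\<close>

lemma analytic_set_open:
  fixes A :: "'a :: metric_space set"
  assumes "open A"
  shows "analytic_set A"
\<comment> \<open>\<open>infdist\<close> to the empty set is 0 by convention, so the whole space is
  treated apart.\<close>
proof (cases "A = UNIV")
  case True
  then show ?thesis by (simp add: analytic_set_closed)
next
  case False
  define C where "C = {p :: 'a \<times> (nat \<Rightarrow> real). snd p 0 * infdist (fst p) (- A) = 1}"
  have "closed C"
    unfolding C_def by (intro closed_Collect_eq continuous_intros continuous_coordinate)
  moreover have "A = fst ` C"
  proof (intro equalityI subsetI)
    fix x assume "x \<in> A"
    then have "infdist x (- A) \<noteq> 0"
      using in_closed_iff_infdist_zero[of "- A" x] assms False by auto
    then have "(x, \<lambda>_. 1 / infdist x (- A)) \<in> C" by (simp add: C_def)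
    then show "x \<in> fst ` C" by force
  next
    fix x assume "x \<in> fst ` C"
    then have "infdist x (- A) \<noteq> 0" by (auto simp: C_def)
    then show "x \<in> A" using infdist_zero[of x "- A"] by blast
  qed
  ultimately show ?thesis unfolding analytic_set_def by blast
qed

text \<open>Coordinate 0 records the index of the member, the other coordinates its witness. Where
  coordinate 0 is below \<open>N\<close> only finitely many closed pieces occur, so the infinite
  union is still closed.\<close>

lemma analytic_set_UN:
  fixes A :: "nat \<Rightarrow> 'a :: metric_space set"
  assumes "\<And>i. analytic_set (A i)"
  shows "analytic_set (\<Union>i. A i)"
proof -
  obtain C :: "nat \<Rightarrow> ('a \<times> (nat \<Rightarrow> real)) set" where C: "\<And>i. closed (C i)" "\<And>i. A i = fst ` C i"
    using assms unfolding analytic_set_def by metis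
  define D where "D i = {p. snd p 0 = real i} \<inter> (\<lambda>p. (fst p, \<lambda>n. snd p (Suc n))) -` C i" for i
  have closed_D: "closed (D i)" for i
    unfolding D_def using C(1)
    by (intro closed_Int closed_vimage continuous_reindex closed_Collect_eq continuous_coordinate continuous_on_const)
  have "closed (\<Union>i. D i)"
    unfolding closed_def
  proof (subst open_subopen, intro ballI)
    fix p assume p: "p \<in> - (\<Union>i. D i)"
    obtain N :: nat where N: "snd p 0 + 1 < N" using reals_Archimedean2 by blast
    define T where "T = {p :: 'a \<times> (nat \<Rightarrow> real). snd p 0 < N} \<inter> - (\<Union>i\<in>{..<N}. D i)"
    have "open T"
      unfolding T_def using closed_D
      by (intro open_Int open_Compl closed_UN ballI open_Collect_less continuous_coordinate continuous_on_const) auto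
    moreover have "p \<in> T" using p N by (auto simp: T_def)
    moreover have "T \<subseteq> - (\<Union>i. D i)" by (auto simp: T_def D_def)
    ultimately show "\<exists>T. open T \<and> p \<in> T \<and> T \<subseteq> - (\<Union>i. D i)" by blast
  qed
  moreover have "(\<Union>i. A i) = fst ` (\<Union>i. D i)"
  proof (intro equalityI subsetI)
    fix x assume "x \<in> (\<Union>i. A i)"
    then obtain i z where "(x, z) \<in> C i" using C(2) by fastforce
    then have "(x, case_nat (real i) z) \<in> D i" by (simp add: D_def)
    then show "x \<in> fst ` (\<Union>i. D i)" by force
  next
    fix x assume "x \<in> fst ` (\<Union>i. D i)"
    then show "x \<in> (\<Union>i. A i)" using C(2) by (force simp: D_def)
  qed
  ultimately show ?thesis unfolding analytic_set_def by blast
qed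

text \<open>A point of the intersection has one witness per index; \<open>prod_encode\<close>
  interleaves them into a single sequence.\<close>

lemma analytic_set_INT:
  fixes A :: "nat \<Rightarrow> 'a :: metric_space set"
  assumes "\<And>i. analytic_set (A i)"
  shows "analytic_set (\<Inter>i. A i)"
proof -
  obtain C :: "nat \<Rightarrow> ('a \<times> (nat \<Rightarrow> real)) set" where C: "\<And>i. closed (C i)" "\<And>i. A i = fst ` C i"
    using assms unfolding analytic_set_def by metis
  define D where "D = (\<Inter>i. (\<lambda>p. (fst p, \<lambda>n. snd p (prod_encode (i, n)))) -` C i)"
  have "closed D"
    unfolding D_def using C(1) by (intro closed_INT ballI closed_vimage continuous_reindex)
  moreover have "(\<Inter>i. A i) = fst ` D"
  proof (intro equalityI subsetI)
    fix x assume x: "x \<in> (\<Inter>i. A i)"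
    have "\<forall>i. \<exists>z. (x, z) \<in> C i" using x C(2) by fastforce
    then obtain z where z: "\<And>i. (x, z i) \<in> C i" by metis
    have "(x, \<lambda>n. z (fst (prod_decode n)) (snd (prod_decode n))) \<in> D"
      using z by (simp add: D_def)
    then show "x \<in> fst ` D" by force
  next
    fix x assume "x \<in> fst ` D"
    then show "x \<in> (\<Inter>i. A i)" using C(2) by (force simp: D_def)
  qed
  ultimately show ?thesis unfolding analytic_set_def by blast
qed

text \<open>Complements of analytic sets need not be analytic, so the induction over the
  sigma-algebra carries the complement along.\<close>

lemma analytic_set_borel:
  fixes A :: "'a :: metric_space set"
  assumes "A \<in> sets borel"
  shows "analytic_set A"
proof -
  have "A \<in> sigma_sets UNIV {S. open S}" using assms by (simp add: borel_def)
  then have "analytic_set A \<and> analytic_set (- A)"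
  proof induction
    case (Basic S)
    then show ?case by (simp add: analytic_set_open analytic_set_closed closed_Compl)
  next
    case Empty
    then show ?case by (simp add: analytic_set_closed)
  next
    case (Compl S)
    then show ?case by (simp add: Compl_eq_Diff_UNIV[symmetric])
  next
    case (Union S)
    then have "analytic_set (\<Union>i. S i)" "analytic_set (\<Inter>i. - S i)"
      by (auto intro: analytic_set_UN analytic_set_INT)
    then show ?case by (simp add: Compl_UN)
  qed
  then show ?thesis ..
qed

text \<open>A closed subspace of a complete space is completely metrizable, so by Baire one of the
  countably many closed traces has interior relative to \<open>Z\<close>.\<close>

lemma closed_Baire:
  fixes Z :: "'a :: complete_space set"
  assumes "closed Z" "Z \<noteq> {}" "\<And>j :: nat. closed (H j)" "Z \<subseteq> (\<Union>j. H j)"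
  obtains j W where "open W" "Z \<inter> W \<noteq> {}" "Z \<inter> W \<subseteq> H j"
proof (rule ccontr)
  assume neg: "\<not> thesis"
  let ?X = "top_of_set Z"
  have "?X interior_of \<Union>(range (\<lambda>j. Z \<inter> H j)) = {}"
  proof (rule Baire_category_alt)
    show "completely_metrizable_space ?X \<or> locally_compact_space ?X \<and> regular_space ?X"
      using assms(1) by (intro disjI1 completely_metrizable_space_closedin completely_metrizable_space_euclidean) auto
    fix T assume "T \<in> range (\<lambda>j. Z \<inter> H j)"
    then obtain j where T: "T = Z \<inter> H j" by blast
    have "?X interior_of T = {}"
    proof (rule ccontr)
      assume "?X interior_of T \<noteq> {}"
      moreover have "openin ?X (?X interior_of T)" by simp
      then obtain W where W: "open W" "?X interior_of T = Z \<inter> W" unfolding openin_open by blast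
      moreover have "?X interior_of T \<subseteq> T" by (rule interior_of_subset)
      ultimately show False using that[of W j] neg T by auto
    qed
    then show "closedin ?X T \<and> ?X interior_of T = {}"
      unfolding T using assms(1,3) by (auto simp: closedin_closed)
  qed auto
  moreover have "\<Union>(range (\<lambda>j. Z \<inter> H j)) = topspace ?X" using assms(4) by auto
  ultimately show False using assms(2) by (simp only: interior_of_topspace) simp
qed

subsection \<open>Projections of packing dimension\<close>

context
  fixes m :: nat and \<gamma> :: "(real ^ 'n) set measure"
  assumes inv: "invariant_grassmannian_measure m \<gamma>"
begin

text \<open>Write \<open>A\<close> as the projection of a closed set \<open>C\<close>. Deleting from \<open>C\<close> all basic open sets whose projection has
  packing dimension at most \<open>s\<close> leaves a closed set \<open>Z\<close> all of whose relatively open subsets have a projection of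
  upper box dimension at least \<open>s\<close>. The box dimension result applies simultaneously to countably many of those,
  and by Baire's theorem every countable compact cover of a projection of \<open>A\<close> has a member that contains
  the image of one of them.\<close>

lemma AE_packing_dim_orth_proj_ge_bounded:
  fixes A :: "(real ^ 'n) set"
  assumes bdd: "bounded A" and borel: "A \<in> sets borel" and s: "s < packing_dim A"
  shows "AE V in \<gamma>. s - max 0 (quasi_assouad_dim A - ereal m) \<le> packing_dim (orth_proj V ` A)"
proof (cases "A = {}")
  case True
  have "s - max 0 (quasi_assouad_dim A - ereal m) \<le> s" by (intro ereal_diff_le_self) simp
  also have "\<dots> \<le> packing_dim A" using s by simp
  finally show ?thesis using True by simp
next
  case False
  define e where "e = max 0 (quasi_assouad_dim A - ereal m)"
  obtain C :: "((real ^ 'n) \<times> (nat \<Rightarrow> real)) set" where C: "closed C" "A = fst ` C"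
    using analytic_set_borel[OF borel] unfolding analytic_set_def by blast
  obtain \<B> :: "((real ^ 'n) \<times> (nat \<Rightarrow> real)) set set" where \<B>: "countable \<B>" "topological_basis \<B>"
    using ex_countable_basis by blast
  define \<N> where "\<N> = {U\<in>\<B>. packing_dim (fst ` (C \<inter> U)) \<le> s}"
  define Z where "Z = C - \<Union>\<N>"
  have \<N>: "countable \<N>" "\<And>U. U \<in> \<N> \<Longrightarrow> open U"
    using \<B> by (auto simp: \<N>_def topological_basis_open)
  have "Z \<noteq> {}"
  proof
    assume "Z = {}"
    then have sub: "C \<subseteq> \<Union>\<N>" by (auto simp: Z_def)
    then have "\<N> \<noteq> {}" using C(2) False by auto
    have "packing_dim A \<le> packing_dim (\<Union>((\<lambda>B. fst ` (C \<inter> B)) ` \<N>))"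
      unfolding C(2) using sub by (intro packing_dim_mono) blast
    also have "\<dots> \<le> s"
      using \<N>(1) \<open>\<N> \<noteq> {}\<close> by (intro packing_dim_Union_le) (auto simp: \<N>_def)
    finally show False using s by simp
  qed
  have "closed Z" unfolding Z_def using C(1) \<N>(2) by (intro closed_Diff open_Union) auto
  \<comment> \<open>Otherwise the projection of \<open>C \<inter> U\<close> would be covered by that
    of \<open>Z \<inter> U\<close> and the deleted ones, all of dimension at most \<open>s\<close>,
    and \<open>U\<close> would have been deleted itself.\<close>
  have big: "s < packing_dim (fst ` (Z \<inter> U))" if U: "U \<in> \<B>" "Z \<inter> U \<noteq> {}" for U
  proof (rule ccontr)
    assume *: "\<not> ?thesis"
    define \<A> where "\<A> = insert (fst ` (Z \<inter> U)) ((\<lambda>B. fst ` (C \<inter> B)) ` \<N>)"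
    have "packing_dim (fst ` (C \<inter> U)) \<le> packing_dim (\<Union>\<A>)"
      by (intro packing_dim_mono) (auto simp: \<A>_def Z_def)
    also have "\<dots> \<le> s"
      using * \<N>(1) by (intro packing_dim_Union_le) (auto simp: \<A>_def \<N>_def not_less)
    finally have "U \<in> \<N>" using U by (simp add: \<N>_def)
    then show False using U by (auto simp: Z_def)
  qed
  \<comment> \<open>The exceptional set of subspaces is fixed here, before any cover of a projection
    is chosen; only countably many basic sets are involved.\<close>
  have "AE V in \<gamma>. \<forall>U\<in>{U\<in>\<B>. Z \<inter> U \<noteq> {}}. s - e \<le> upper_box_dim (orth_proj V ` fst ` (Z \<inter> U))"
  proof (subst AE_ball_countable)
    show "countable {U\<in>\<B>. Z \<inter> U \<noteq> {}}" using \<B>(1) by simp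
    show "\<forall>U\<in>{U\<in>\<B>. Z \<inter> U \<noteq> {}}. AE V in \<gamma>. s - e \<le> upper_box_dim (orth_proj V ` fst ` (Z \<inter> U))"
    proof
      fix U assume U: "U \<in> {U\<in>\<B>. Z \<inter> U \<noteq> {}}"
      let ?G = "fst ` (Z \<inter> U)"
      have G: "?G \<subseteq> A" "?G \<noteq> {}" using U C(2) by (auto simp: Z_def)
      then have bG: "bounded ?G" using bdd bounded_subset by blast
      have "s \<le> upper_box_dim ?G"
        using big[of U] U packing_dim_le_upper_box_dim[OF bG G(2)] by simp
      \<comment> \<open>Monotonicity of the quasi-Assouad dimension lets one loss \<open>e\<close>
        serve all pieces.\<close>
      moreover have "max 0 (quasi_assouad_dim ?G - ereal m) \<le> e"
        unfolding e_def using quasi_assouad_dim_subset[OF G(1)] by (intro max.mono ereal_minus_mono) auto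
      ultimately have "s - e \<le> upper_box_dim ?G - max 0 (quasi_assouad_dim ?G - ereal m)"
        by (rule ereal_minus_mono)
      then show "AE V in \<gamma>. s - e \<le> upper_box_dim (orth_proj V ` ?G)"
        using AE_box_dim_orth_proj_ge[OF inv bG G(2)] by (auto elim: AE_mp intro: order_trans)
    qed
  qed
  then show ?thesis
  proof (rule AE_mp, intro AE_I2 impI)
    fix V assume V: "V \<in> space \<gamma>"
      and *: "\<forall>U\<in>{U\<in>\<B>. Z \<inter> U \<noteq> {}}. s - e \<le> upper_box_dim (orth_proj V ` fst ` (Z \<inter> U))"
    have sub: "subspace V" using V in_space_invariant_measure[OF inv] by blast
    have cont: "continuous_on UNIV (\<lambda>p :: (real ^ 'n) \<times> (nat \<Rightarrow> real). orth_proj V (fst p))"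
      by (rule continuous_on_compose2[where t = UNIV and g = "orth_proj V" and f = fst])
        (auto intro: continuous_on_orth_proj[OF sub] continuous_on_fst continuous_on_id)
    show "s - max 0 (quasi_assouad_dim A - ereal m) \<le> packing_dim (orth_proj V ` A)"
      unfolding e_def[symmetric] packing_dim_def
    proof (rule Inf_greatest)
      fix z assume "z \<in> {(SUP j. upper_box_dim (K j)) | K :: nat \<Rightarrow> (real ^ 'n) set.
        (\<forall>j. compact (K j) \<and> K j \<noteq> {}) \<and> orth_proj V ` A \<subseteq> (\<Union>j. K j)}"
      then obtain K :: "nat \<Rightarrow> (real ^ 'n) set" where K: "z = (SUP j. upper_box_dim (K j))"
        "\<And>j. compact (K j)" "orth_proj V ` A \<subseteq> (\<Union>j. K j)"
        by blast
      obtain j W where W: "open W" "Z \<inter> W \<noteq> {}" "Z \<inter> W \<subseteq> (\<lambda>p. orth_proj V (fst p)) -` K j"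
      proof (rule closed_Baire[OF \<open>closed Z\<close> \<open>Z \<noteq> {}\<close>])
        show "closed ((\<lambda>p :: (real ^ 'n) \<times> (nat \<Rightarrow> real). orth_proj V (fst p)) -` K j)" for j
          by (intro closed_vimage compact_imp_closed K cont)
        show "Z \<subseteq> (\<Union>j. (\<lambda>p. orth_proj V (fst p)) -` K j)"
        proof
          fix p assume "p \<in> Z"
          then have "orth_proj V (fst p) \<in> orth_proj V ` A" using C(2) by (simp add: Z_def)
          then show "p \<in> (\<Union>j. (\<lambda>p. orth_proj V (fst p)) -` K j)" using K(3) by blast
        qed
      qed
      obtain p where p: "p \<in> Z" "p \<in> W" using W(2) by blast
      obtain U where U: "U \<in> \<B>" "p \<in> U" "U \<subseteq> W"
        using topological_basisE[OF \<B>(2) W(1) p(2)] by blast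
      have "s - e \<le> upper_box_dim (orth_proj V ` fst ` (Z \<inter> U))"
        using * U p by blast
      also have "\<dots> \<le> upper_box_dim (K j)"
        using W(3) U p by (intro upper_box_dim_mono compact_imp_bounded K) auto
      also have "\<dots> \<le> z" unfolding K(1) by (rule SUP_upper) simp
      finally show "s - e \<le> z" .
    qed
  qed
qed

text \<open>Countable stability finds a bounded part of \<open>F\<close> whose packing dimension
  still exceeds \<open>s\<close>. Letting \<open>s\<close> run through the rationals keeps the null
  sets countable in number.\<close>

lemma AE_packing_dim_orth_proj_ge:
  fixes F :: "(real ^ 'n) set"
  assumes "F \<in> sets borel"
  shows "AE V in \<gamma>. packing_dim F - max 0 (quasi_assouad_dim F - ereal m) \<le> packing_dim (orth_proj V ` F)"
proof -
  define e where "e = max 0 (quasi_assouad_dim F - ereal m)"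
  have "AE V in \<gamma>. s - e \<le> packing_dim (orth_proj V ` F)" if s: "s < packing_dim F" for s
  proof -
    have "\<exists>i::nat. s < packing_dim (F \<inter> cball 0 (real i))"
    proof (rule ccontr)
      assume *: "\<not> ?thesis"
      have "F = \<Union>(range (\<lambda>i::nat. F \<inter> cball 0 (real i)))"
        using real_arch_simple by auto
      moreover have "packing_dim (\<Union>(range (\<lambda>i::nat. F \<inter> cball 0 (real i)))) \<le> s"
        using * by (intro packing_dim_Union_le) (auto simp: not_less)
      ultimately show False using s by simp
    qed
    then obtain i :: nat where i: "s < packing_dim (F \<inter> cball 0 (real i))" by blast
    let ?A = "F \<inter> cball 0 (real i)"
    have "AE V in \<gamma>. s - max 0 (quasi_assouad_dim ?A - ereal m) \<le> packing_dim (orth_proj V ` ?A)"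
      using assms i by (intro AE_packing_dim_orth_proj_ge_bounded) auto
    then show ?thesis
    proof (rule AE_mp, intro AE_I2 impI)
      fix V assume "s - max 0 (quasi_assouad_dim ?A - ereal m) \<le> packing_dim (orth_proj V ` ?A)"
      moreover have "packing_dim (orth_proj V ` ?A) \<le> packing_dim (orth_proj V ` F)"
        by (intro packing_dim_mono) auto
      moreover have "s - e \<le> s - max 0 (quasi_assouad_dim ?A - ereal m)"
        unfolding e_def using quasi_assouad_dim_subset[of ?A F]
        by (intro ereal_minus_mono max.mono) auto
      ultimately show "s - e \<le> packing_dim (orth_proj V ` F)" by simp
    qed
  qed
  then have "AE V in \<gamma>. \<forall>s::rat. ereal (of_rat s) < packing_dim F \<longrightarrow>
      ereal (of_rat s) - e \<le> packing_dim (orth_proj V ` F)"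
    unfolding AE_all_countable by auto
  then show ?thesis
    unfolding e_def[symmetric]
  proof (rule AE_mp, intro AE_I2 impI)
    fix V assume *: "\<forall>s::rat. ereal (of_rat s) < packing_dim F \<longrightarrow>
      ereal (of_rat s) - e \<le> packing_dim (orth_proj V ` F)"
    show "packing_dim F - e \<le> packing_dim (orth_proj V ` F)"
    \<comment> \<open>In the infinite case the left side is \<open>-\<infinity>\<close>, as the
      packing dimension is below \<open>\<infinity>\<close>; otherwise \<open>e\<close> is finite
      and can be moved across.\<close>
    proof (cases "e = \<infinity>")
      case True
      then show ?thesis using packing_dim_less_infinity[of F] by (cases "packing_dim F") auto
    next
      case False
      moreover have "0 \<le> e" by (simp add: e_def)
      ultimately have e: "\<bar>e\<bar> \<noteq> \<infinity>" by auto
      have "packing_dim F \<le> packing_dim (orth_proj V ` F) + e"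
      proof (rule ccontr)
        assume "\<not> ?thesis"
        then obtain s :: rat where "packing_dim (orth_proj V ` F) + e < ereal (of_rat s)" "ereal (of_rat s) < packing_dim F"
          using ereal_dense3[of "packing_dim (orth_proj V ` F) + e" "packing_dim F"] by (auto simp: not_le)
        with * show False by (auto simp: ereal_minus_le[OF e])
      qed
      then show ?thesis by (simp add: ereal_minus_le[OF e])
    qed
  qed
qed

end

text \<open>The bound on \<open>q\<close> limits the loss to \<open>max 0 (X - m)\<close>, and
  \<open>X - max 0 (X - m) = min m X\<close>. Here \<open>X < \<infinity>\<close> matters because
  \<open>\<infinity> - \<infinity> = \<infinity>\<close> in \<open>ereal\<close>.\<close>

lemma eq_min_of_ge_minus:
  fixes X Y q :: ereal
  assumes "X < \<infinity>" "q \<le> max (ereal m) X" "X - max 0 (q - ereal m) \<le> Y" "Y \<le> ereal m" "Y \<le> X"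
  shows "Y = min (ereal m) X"
proof (rule antisym)
  have "max 0 (q - ereal m) \<le> max 0 (max (ereal m) X - ereal m)"
    using assms(2) by (intro max.mono ereal_minus_mono) auto
  then have "X - max 0 (max (ereal m) X - ereal m) \<le> X - max 0 (q - ereal m)"
    by (intro ereal_minus_mono) auto
  also note assms(3)
  also have "X - max 0 (max (ereal m) X - ereal m) = min (ereal m) X"
    using assms(1) by (cases X) (auto simp: max_def min_def)
  finally show "min (ereal m) X \<le> Y" .
qed (use assms in simp)

theorem corollary1p3:
  fixes F :: "(real ^ 'n) set" and m :: nat and \<gamma> :: "(real ^ 'n) set measure"
  assumes "1 \<le> m" and "m < CARD('n)"
    and "invariant_grassmannian_measure m \<gamma>"
    and "F \<noteq> {}"
  shows
    "(bounded F \<longrightarrow>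
        (quasi_assouad_dim F \<le> max (ereal m) (upper_box_dim F) \<longrightarrow>
          (AE V in \<gamma>. upper_box_dim (orth_proj V ` F) = min (ereal m) (upper_box_dim F))) \<and>
        (AE V in \<gamma>. upper_box_dim (orth_proj V ` F)
          \<ge> upper_box_dim F - max 0 (quasi_assouad_dim F - ereal m))) \<and>
     (bounded F \<longrightarrow>
        (quasi_assouad_dim F \<le> max (ereal m) (lower_box_dim F) \<longrightarrow>
          (AE V in \<gamma>. lower_box_dim (orth_proj V ` F) = min (ereal m) (lower_box_dim F))) \<and>
        (AE V in \<gamma>. lower_box_dim (orth_proj V ` F)
          \<ge> lower_box_dim F - max 0 (quasi_assouad_dim F - ereal m))) \<and>
     (F \<in> sets borel \<longrightarrow>
        (quasi_assouad_dim F \<le> max (ereal m) (packing_dim F) \<longrightarrow>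
          (AE V in \<gamma>. packing_dim (orth_proj V ` F) = min (ereal m) (packing_dim F))) \<and>
        (AE V in \<gamma>. packing_dim (orth_proj V ` F)
          \<ge> packing_dim F - max 0 (quasi_assouad_dim F - ereal m)))"
proof -
  note inv = assms(3)
  have sub: "subspace V" "dim V = m" if "V \<in> space \<gamma>" for V
    using that in_space_invariant_measure[OF inv] by auto
  have im: "orth_proj V ` F \<subseteq> V" "bounded F \<Longrightarrow> bounded (orth_proj V ` F)" if "V \<in> space \<gamma>" for V
    using orth_proj_properties(1)[OF sub(1)[OF that]] bounded_orth_proj_image[OF sub(1)[OF that]]
    by auto
  \<comment> \<open>Upper bounds for every \<open>V\<close>: the projection lies in an
    \<open>m\<close>-dimensional subspace and does not increase distances. Only the lower bounds are
    probabilistic.\<close>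
  have box: "upper_box_dim (orth_proj V ` F) \<le> ereal m" "upper_box_dim (orth_proj V ` F) \<le> upper_box_dim F"
    "lower_box_dim (orth_proj V ` F) \<le> ereal m" "lower_box_dim (orth_proj V ` F) \<le> lower_box_dim F"
    if "V \<in> space \<gamma>" "bounded F" for V
  proof -
    have "orth_proj V ` F \<noteq> {}" using assms(4) by simp
    then show "upper_box_dim (orth_proj V ` F) \<le> ereal m"
      using upper_box_dim_le_dim_subspace[OF sub(1) im(1) im(2)] sub(2) that by metis
    then show "lower_box_dim (orth_proj V ` F) \<le> ereal m"
      using lower_box_dim_le_upper_box_dim order_trans by blast
    show "upper_box_dim (orth_proj V ` F) \<le> upper_box_dim F" "lower_box_dim (orth_proj V ` F) \<le> lower_box_dim F"
      using box_dim_orth_proj_le[OF sub(1) _ assms(4)] that by blast+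
  qed
  have pack: "packing_dim (orth_proj V ` F) \<le> ereal m" "packing_dim (orth_proj V ` F) \<le> packing_dim F"
    if "V \<in> space \<gamma>" for V
    using packing_dim_le_dim_subspace[OF sub(1) im(1)] sub(2) packing_dim_orth_proj_le[OF sub(1)] that by metis+
  note box_ge = AE_box_dim_orth_proj_ge[OF inv _ assms(4)]
  note pack_ge = AE_packing_dim_orth_proj_ge[OF inv]
  show ?thesis
  proof (intro conjI impI)
    assume F: "bounded F"
    have upper: "upper_box_dim F < \<infinity>" using upper_box_dim_less_infinity[OF F assms(4)] .
    then have lower: "lower_box_dim F < \<infinity>"
      by (rule le_less_trans[OF lower_box_dim_le_upper_box_dim])
    show "AE V in \<gamma>. upper_box_dim F - max 0 (quasi_assouad_dim F - ereal m) \<le> upper_box_dim (orth_proj V ` F)"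
      "AE V in \<gamma>. lower_box_dim F - max 0 (quasi_assouad_dim F - ereal m) \<le> lower_box_dim (orth_proj V ` F)"
      using box_ge[OF F] by (auto elim: AE_mp)
    show "AE V in \<gamma>. upper_box_dim (orth_proj V ` F) = min (ereal m) (upper_box_dim F)"
      if "quasi_assouad_dim F \<le> max (ereal m) (upper_box_dim F)"
      using box_ge[OF F]
      by (rule AE_mp, intro AE_I2 impI eq_min_of_ge_minus[OF upper that]) (use box F in auto)
    show "AE V in \<gamma>. lower_box_dim (orth_proj V ` F) = min (ereal m) (lower_box_dim F)"
      if "quasi_assouad_dim F \<le> max (ereal m) (lower_box_dim F)"
      using box_ge[OF F]
      by (rule AE_mp, intro AE_I2 impI eq_min_of_ge_minus[OF lower that]) (use box F in auto)
  next
    assume F: "F \<in> sets borel"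
    show "AE V in \<gamma>. packing_dim F - max 0 (quasi_assouad_dim F - ereal m) \<le> packing_dim (orth_proj V ` F)"
      using pack_ge[OF F] .
    show "AE V in \<gamma>. packing_dim (orth_proj V ` F) = min (ereal m) (packing_dim F)"
      if "quasi_assouad_dim F \<le> max (ereal m) (packing_dim F)"
      using pack_ge[OF F]
      by (rule AE_mp, intro AE_I2 impI eq_min_of_ge_minus[OF packing_dim_less_infinity that]) (use pack in auto)
  qed
qed

end
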